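(* Let $\rho^0,\mathbf v^0,\tau^0,\mathbf q^0$ be given initial data with $\mathbf q^0=\nabla\rho^0$ in $\Omega$ and $\mathbf v^0=\mathbf 0$, $(\mathbf q^0)^T\mathbf n=0$ on $\partial\Omega$. Let $(\rho^{n},\mathbf v^{n},\tau^{n},\mathbf q^{n})_{0\le n\le N}$ be (sufficiently smooth) functions on $\Omega$ solving the temporally semidiscrete scheme: for $0\le n\le N-1$, $\mathbf v^{n+1}=\mathbf 0$ and $(\mathbf q^{n+1})^T\mathbf n=0$ on $\partial\Omega$, and in $\Omega$ $$0=\frac{\rho^{n+1}-\rho^n}{k_n}+\operatorname{div}\big(\rho^{n+\frac12}\mathbf v^{n+\frac12}\big),$$ $$0=\rho^{n+\frac12}\,\frac{\mathbf v^{n+1}-\mathbf v^n}{k_n}+\operatorname{div}\big(\rho^{n+\frac12}\mathbf v^{n+\frac12}\otimes\mathbf v^{n+\frac12}\big)-\operatorname{div}\big(\rho^{n+\frac12}\mathbf v^{n+\frac12}\big)\mathbf v^{n+\frac12}+\rho^{n+\frac12}\nabla\tau^{n+\frac12}-\tfrac12\rho^{n+\frac12}\nabla\big(|\mathbf v^{n+\frac12}|^2\big)-\mu\Delta\mathbf v^{n+\frac12},$$ $$0=\tau^{n+\frac12}-\frac{W(\rho^{n+1})-W(\rho^n)}{\rho^{n+1}-\rho^n}+\gamma\operatorname{div}\big(\mathbf q^{n+\frac12}\big)-\tfrac14\big(|\mathbf v^{n+1}|^2+|\mathbf v^n|^2\big),$$ $$0=\mathbf q^{n+1}-\nabla\rho^{n+1}.$$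 Then for all $0\le n\le N$ $$\int_\Omega W(\rho^n)+\tfrac12\rho^n|\mathbf v^n|^2+\tfrac\gamma2|\mathbf q^n|^2\,dx=\int_\Omega W(\rho^0)+\tfrac12\rho^0|\mathbf v^0|^2+\tfrac\gamma2|\mathbf q^0|^2\,dx-\mu\sum_{j=0}^{n-1}k_j\int_\Omega|\mathrm D\mathbf v^{j+\frac12}|^2\,dx.$$
   Context: $\Omega\subset\mathbb R^d$, $d\in\{1,2,3\}$, is a bounded domain with outward normal $\mathbf n$. $0=t_0<t_1<\dots<t_N=T$ is a partition of $[0,T]$, $k_n:=t_{n+1}-t_n$, and $F^{n+\frac12}:=\frac12(F^n+F^{n+1})$ for any sequence $F^n$. $W$ is a (smooth) double-well potential, $\mu\ge0$ a viscosity coefficient, $\gamma$ a capillarity coefficient. $\mathrm D\mathbf v$ is the Jacobian of $\mathbf v$, $|\mathrm D\mathbf v|$ its Frobenius norm, and the Laplacian of a vector field is componentwise. The difference quotient $\frac{W(\rho^{n+1})-W(\rho^n)}{\rho^{n+1}-\rho^n}$ is understood as $W'(\rho^n)$ at points where $\rho^{n+1}=\rho^n$. *)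

theory Defs
  imports "HOL-Analysis.Analysis"
begin

section \<open>Differential operators on \<open>\<real>\<^sup>d\<close>\<close>

text \<open>The dimension is \<^term>\<open>CARD('d)\<close>. All operators are applied at points of an open set
  at which their argument is differentiable. The Jacobian is the library's \<^const>\<open>jacobian\<close>; the
  norm of type \<^typ>\<open>real ^ 'd ^ 'd\<close> is the Frobenius norm.\<close>

definition partial_deriv ::
    "'d \<Rightarrow> (real ^ 'd \<Rightarrow> 'b::real_normed_vector) \<Rightarrow> real ^ 'd \<Rightarrow> 'b"
  where "partial_deriv i f x = frechet_derivative f (at x) (axis i 1)"

definition grad :: "(real ^ 'd \<Rightarrow> real) \<Rightarrow> real ^ 'd \<Rightarrow> real ^ 'd"
  where "grad f x = (\<chi> i. partial_deriv i f x)"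

definition divergence :: "(real ^ 'd \<Rightarrow> real ^ 'd) \<Rightarrow> real ^ 'd \<Rightarrow> real"
  where "divergence F x = (\<Sum>i\<in>UNIV. partial_deriv i (\<lambda>y. F y $ i) x)"

text \<open>Divergence of a matrix field, taken row by row.\<close>

definition divergence_mat :: "(real ^ 'd \<Rightarrow> real ^ 'd ^ 'd) \<Rightarrow> real ^ 'd \<Rightarrow> real ^ 'd"
  where "divergence_mat A x = (\<chi> i. divergence (\<lambda>y. A y $ i) x)"

definition outer :: "real ^ 'd \<Rightarrow> real ^ 'd \<Rightarrow> real ^ 'd ^ 'd"  (infixr "\<otimes>\<^sub>v" 75)
  where "a \<otimes>\<^sub>v b = (\<chi> i j. a $ i * b $ j)"

definition laplacian :: "(real ^ 'd \<Rightarrow> real) \<Rightarrow> real ^ 'd \<Rightarrow> real"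
  where "laplacian f x = (\<Sum>j\<in>UNIV. partial_deriv j (partial_deriv j f) x)"

definition vec_laplacian :: "(real ^ 'd \<Rightarrow> real ^ 'd) \<Rightarrow> real ^ 'd \<Rightarrow> real ^ 'd"
  where "vec_laplacian v x = (\<chi> i. laplacian (\<lambda>y. v y $ i) x)"

text \<open>The space \<open>C\<^sup>k\<close> up to the boundary: \<open>f\<close> is \<open>k\<close> times continuously differentiable on the open
  set \<open>\<Omega>\<close>, and \<open>f\<close> and its partial derivatives up to order \<open>k\<close> extend continuously to the closure.
  On the boundary, \<open>f\<close> is itself this extension; the extensions of the derivatives are the \<open>g\<close>.\<close>

primrec Ck_closure :: "nat \<Rightarrow> (real ^ 'd) set \<Rightarrow> (real ^ 'd \<Rightarrow> 'b::real_normed_vector) \<Rightarrow> bool"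
  where
    "Ck_closure 0 \<Omega> f \<longleftrightarrow> continuous_on (closure \<Omega>) f"
  | "Ck_closure (Suc k) \<Omega> f \<longleftrightarrow>
       continuous_on (closure \<Omega>) f \<and> f differentiable_on \<Omega> \<and>
       (\<forall>i. \<exists>g. Ck_closure k \<Omega> g \<and> (\<forall>x\<in>\<Omega>. g x = partial_deriv i f x))"


section \<open>Bounded domains with outward normal\<close>

text \<open>\<open>\<nu>\<close> is the outward unit normal of \<open>\<Omega>\<close> at \<open>x\<close>: near \<open>x\<close>, the set \<open>\<Omega>\<close> is the sublevel set of a
  \<open>C\<^sup>1\<close> function \<open>g\<close> without critical points, with gradient \<open>g'\<close>, and \<open>x\<close> lies on its zero level
  (hence on the boundary of \<open>\<Omega>\<close>). Then \<open>\<nu>\<close> does not depend on the choice of \<open>g\<close>.\<close>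

definition outward_unit_normal :: "(real ^ 'd) set \<Rightarrow> real ^ 'd \<Rightarrow> real ^ 'd \<Rightarrow> bool"
  where "outward_unit_normal \<Omega> x \<nu> \<longleftrightarrow>
    (\<exists>U g g'. open U \<and> x \<in> U \<and>
       (\<forall>y\<in>U. (g has_derivative (\<lambda>h. g' y \<bullet> h)) (at y)) \<and>
       continuous_on U g' \<and> (\<forall>y\<in>U. g' y \<noteq> 0) \<and>
       \<Omega> \<inter> U = {y\<in>U. g y < (0::real)} \<and> g x = 0 \<and>
       \<nu> = g' x /\<^sub>R norm (g' x))"

definition regular_boundary :: "(real ^ 'd) set \<Rightarrow> (real ^ 'd) set"
  where "regular_boundary \<Omega> = {x \<in> frontier \<Omega>. \<exists>\<nu>. outward_unit_normal \<Omega> x \<nu>}"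

text \<open>The Minkowski content of codimension one vanishes: the \<open>\<epsilon>\<close>-neighbourhood has volume \<open>o(\<epsilon>)\<close>.\<close>

definition null_content_codim1 :: "(real ^ 'd) set \<Rightarrow> bool"
  where "null_content_codim1 S \<longleftrightarrow>
    ((\<lambda>\<epsilon>. measure lebesgue (\<Union>x\<in>S. ball x \<epsilon>) / \<epsilon>) \<longlongrightarrow> 0) (at_right 0)"

text \<open>The outward normal field \<open>\<nu>\<close> is required on the boundary except for a negligible set of
  corners and edges. All \<open>C\<^sup>1\<close> domains (empty exceptional set), in particular bounded open
  intervals, and all polygonal and polyhedral Lipschitz domains are covered.\<close>

definition bounded_domain_with_normal :: "(real ^ 'd) set \<Rightarrow> (real ^ 'd \<Rightarrow> real ^ 'd) \<Rightarrow> bool"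
  where "bounded_domain_with_normal \<Omega> \<nu> \<longleftrightarrow>
    open \<Omega> \<and> connected \<Omega> \<and> \<Omega> \<noteq> {} \<and> bounded \<Omega> \<and>
    null_content_codim1 (frontier \<Omega> - regular_boundary \<Omega>) \<and>
    (\<forall>x\<in>regular_boundary \<Omega>. outward_unit_normal \<Omega> x (\<nu> x))"


section \<open>The potential and the time discretisation\<close>

text \<open>\<open>W\<close> is smooth on the open interval \<open>I\<close> of admissible densities and has two wells \<open>a < c\<close>
  separated by a barrier \<open>b\<close>, possibly after subtraction of a linear function \<open>m\<cdot>\<rho>\<close>. This tilt
  is used for van der Waals energies, whose wells are the points of contact with a common tangent.\<close>

definition double_well :: "real set \<Rightarrow> (real \<Rightarrow> real) \<Rightarrow> bool"
  where "double_well I W \<longleftrightarrow>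
    open I \<and> is_interval I \<and>
    (\<forall>k. \<forall>r\<in>I. (deriv ^^ k) W field_differentiable at r) \<and>
    (\<exists>m a b c. {a, b, c} \<subseteq> I \<and> a < b \<and> b < c \<and>
       (let V = (\<lambda>r. W r - m * r) in
          (\<forall>\<^sub>F r in nhds a. V a \<le> V r) \<and> (\<forall>\<^sub>F r in nhds c. V c \<le> V r) \<and>
          V a < V b \<and> V c < V b))"

definition diff_quotient :: "(real \<Rightarrow> real) \<Rightarrow> real \<Rightarrow> real \<Rightarrow> real"
  where "diff_quotient W r s = (if s = r then deriv W r else (W s - W r) / (s - r))"

definition midpt :: "(nat \<Rightarrow> 'a \<Rightarrow> 'b::real_vector) \<Rightarrow> nat \<Rightarrow> 'a \<Rightarrow> 'b"
  where "midpt F n x = (1/2) *\<^sub>R (F n x + F (Suc n) x)"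

definition total_energy ::
    "(real ^ 'd) set \<Rightarrow> (real \<Rightarrow> real) \<Rightarrow> real \<Rightarrow> (real ^ 'd \<Rightarrow> real) \<Rightarrow>
     (real ^ 'd \<Rightarrow> real ^ 'd) \<Rightarrow> (real ^ 'd \<Rightarrow> real ^ 'd) \<Rightarrow> real"
  where "total_energy \<Omega> W \<gamma> \<rho> v q =
    (LINT x:\<Omega>|lborel. W (\<rho> x) + 1/2 * \<rho> x * (norm (v x))\<^sup>2 + \<gamma>/2 * (norm (q x))\<^sup>2)"

end

theory Submission
  imports Defs
begin

text \<open>One time step from \<open>n\<close> to \<open>n + 1\<close> changes the energy density by the divergence of an explicit
  flux minus \<open>k \<mu> |Du|\<^sup>2\<close>, where \<open>u\<close> is the midpoint velocity; this is
  \<open>energy_balance_pointwise\<close>. Write \<open>r\<close>, \<open>s\<close>, \<open>p\<close> for the midpoints of \<open>\<rho>\<close>, \<open>\<tau>\<close>, \<open>q\<close>, and \<open>d\<close> for the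
  increment of \<open>\<rho>\<close>. The mass equation is multiplied by \<open>s\<close> and the momentum equation by \<open>u\<close>. The three
  convective terms then cancel pointwise, the remaining transport terms combine to the divergence of
  \<open>s r u\<close>, and the viscous term is a divergence minus \<open>|Du|\<^sup>2\<close>. In the product \<open>s d\<close> the difference
  quotient turns into the exact increment of \<open>W\<close>, the quarter sum of squares times \<open>d\<close> complements
  \<open>r (v\<^sup>n\<^sup>+\<^sup>1 - v\<^sup>n) \<bullet> u\<close> to the exact increment of the kinetic energy \<open>1/2 \<rho> |v|\<^sup>2\<close>, and, since \<open>q = \<nabla>\<rho>\<close> at
  both time levels, the term \<open>\<gamma> d div p\<close> is the divergence of \<open>\<gamma> d p\<close> minus the increment of
  \<open>\<gamma>/2 |q|\<^sup>2\<close>. It is because all nonlinear terms are evaluated at midpoints or by difference quotients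
  that these discrete chain rules hold without remainder.

  The flux is \<open>-k s r u + \<gamma> d p + k \<mu> (Du)\<^sup>T u\<close>. Its first and last parts vanish on the boundary because
  \<open>u\<close> does, and the middle part is tangential there because \<open>p\<close> is. So its divergence
  integrates to zero, and summation over the time steps gives the claim.

  The analytic core is the corresponding case of the divergence theorem,
  \<open>divergence_theorem_tangential\<close>, on a domain with singular boundary points. Fields that are tangential
  to the boundary allow a proof in which no surface integral occurs. The identity
  \<open>\<integral> \<phi> div F + F \<bullet> \<nabla>\<phi> = 0\<close> is clear for \<open>\<phi>\<close> with compact support in the domain
  (\<open>green_form_compact_support\<close>). For \<open>\<phi>\<close> supported near a regular boundary point, where the domain
  is \<open>{g < 0}\<close>, one multiplies \<open>\<phi>\<close> by a cutoff that depends on \<open>g/\<delta>\<close>; its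
  gradient has size \<open>1/\<delta>\<close> on a layer of volume \<open>O(\<delta>)\<close>, on which \<open>F \<bullet> \<nabla>g\<close> tends to zero
  (\<open>green_form_boundary_chart\<close>). Finitely many such neighbourhoods are glued. The singular points are
  removed by a cutoff at scale \<open>\<epsilon>\<close>, the cost of which is controlled by the volume
  \<open>o(\<epsilon>)\<close> of their \<open>\<epsilon>\<close>-neighbourhood.\<close>

section \<open>Calculus of functions of class \<open>C\<^sup>1\<close> up to the boundary\<close>

lemma has_partial_deriv: "(f has_derivative f') (at x) \<Longrightarrow> partial_deriv i f x = f' (axis i 1)"
  unfolding partial_deriv_def by (metis frechet_derivative_at)

lemma partial_deriv_nth:
  assumes "F differentiable (at x)"
  shows "partial_deriv i (\<lambda>y. F y $ j) x = partial_deriv i F x $ j"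
proof -
  have "((\<lambda>y. F y $ j) has_derivative (\<lambda>h. frechet_derivative F (at x) h $ j)) (at x)"
    using assms by (intro bounded_linear.has_derivative[OF bounded_linear_vec_nth]) (simp add: frechet_derivative_works)
  from has_partial_deriv[OF this] show ?thesis by (simp add: partial_deriv_def)
qed

lemma Ck_closure_differentiable:
  "Ck_closure (Suc k) \<Omega> f \<Longrightarrow> open \<Omega> \<Longrightarrow> x \<in> \<Omega> \<Longrightarrow> f differentiable (at x)"
  by (simp add: differentiable_on_eq_differentiable_at)

lemma divergence_eq_sum_partial_deriv:
  "F differentiable (at x) \<Longrightarrow> divergence F x = (\<Sum>i\<in>UNIV. partial_deriv i F x $ i)"
  by (simp add: divergence_def partial_deriv_nth)

lemma Ck_closure_partial_derivs:
  assumes "Ck_closure (Suc k) \<Omega> f"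
  shows "\<exists>G. \<forall>i. Ck_closure k \<Omega> (G i) \<and> (\<forall>x\<in>\<Omega>. G i x = partial_deriv i f x)"
proof -
  have "\<forall>i. \<exists>g. Ck_closure k \<Omega> g \<and> (\<forall>x\<in>\<Omega>. g x = partial_deriv i f x)"
    using assms unfolding Ck_closure.simps by (elim conjE)
  from choice[OF this] show ?thesis .
qed

text \<open>On a bounded domain the divergence is therefore bounded, which makes all integrals below exist.\<close>

lemma divergence_extends_continuously:
  assumes "open \<Omega>" "Ck_closure 1 \<Omega> F"
  shows "\<exists>d. continuous_on (closure \<Omega>) d \<and> (\<forall>x\<in>\<Omega>. d x = divergence F x)"
proof -
  have F: "Ck_closure (Suc 0) \<Omega> F" using assms(2) by simp
  obtain G where G: "\<forall>i. Ck_closure 0 \<Omega> (G i) \<and> (\<forall>x\<in>\<Omega>. G i x = partial_deriv i F x)"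
    using Ck_closure_partial_derivs[OF F] by (rule exE)
  have "continuous_on (closure \<Omega>) (\<lambda>x. \<Sum>i\<in>UNIV. G i x $ i)"
    by (intro continuous_intros) (use G in simp)
  moreover have "(\<Sum>i\<in>UNIV. G i x $ i) = divergence F x" if "x \<in> \<Omega>" for x
    using that G Ck_closure_differentiable[OF F assms(1) that]
    by (simp add: divergence_eq_sum_partial_deriv)
  ultimately show ?thesis by (intro exI[of _ "\<lambda>x. \<Sum>i\<in>UNIV. G i x $ i"]) simp
qed

lemma Ck_closure_Suc_D:
  "Ck_closure (Suc k) \<Omega> f \<Longrightarrow> Ck_closure k \<Omega> f"
proof (induction k arbitrary: f)
  case (Suc k)
  obtain G where G: "\<forall>i. Ck_closure (Suc k) \<Omega> (G i) \<and> (\<forall>x\<in>\<Omega>. G i x = partial_deriv i f x)"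
    using Ck_closure_partial_derivs[OF Suc.prems] by (rule exE)
  then have "\<forall>i. \<exists>g. Ck_closure k \<Omega> g \<and> (\<forall>x\<in>\<Omega>. g x = partial_deriv i f x)" using Suc.IH by meson
  moreover have "continuous_on (closure \<Omega>) f" "f differentiable_on \<Omega>"
    using Suc.prems unfolding Ck_closure.simps(2)[of "Suc k"] by - (elim conjE, assumption)+
  ultimately show ?case unfolding Ck_closure.simps(2) by (intro conjI)
qed simp

lemma C1_closureI:
  assumes "continuous_on (closure \<Omega>) f" "open \<Omega>" "\<And>x. x \<in> \<Omega> \<Longrightarrow> f differentiable (at x)"
    "\<And>i. continuous_on (closure \<Omega>) (G i)" "\<And>i x. x \<in> \<Omega> \<Longrightarrow> partial_deriv i f x = G i x"
  shows "Ck_closure 1 \<Omega> f"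
proof -
  have "\<forall>i. \<exists>g. Ck_closure 0 \<Omega> g \<and> (\<forall>x\<in>\<Omega>. g x = partial_deriv i f x)"
  proof
    fix i
    show "\<exists>g. Ck_closure 0 \<Omega> g \<and> (\<forall>x\<in>\<Omega>. g x = partial_deriv i f x)"
      by (rule exI[of _ "G i"]) (simp add: assms)
  qed
  moreover have "f differentiable_on \<Omega>"
    using assms(2,3) by (simp add: differentiable_on_eq_differentiable_at)
  ultimately show ?thesis unfolding One_nat_def Ck_closure.simps(2) using assms(1) by (intro conjI)
qed

lemma C1_closureD:
  assumes "Ck_closure 1 \<Omega> f" "open \<Omega>"
  shows "continuous_on (closure \<Omega>) f"
    and "\<And>x. x \<in> \<Omega> \<Longrightarrow> f differentiable (at x)"
    and "\<exists>G. \<forall>i. continuous_on (closure \<Omega>) (G i) \<and> (\<forall>x\<in>\<Omega>. G i x = partial_deriv i f x)"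
proof -
  have f: "Ck_closure (Suc 0) \<Omega> f" using assms(1) by (simp only: One_nat_def)
  show "continuous_on (closure \<Omega>) f" using Ck_closure_Suc_D[OF f] by simp
  show "\<And>x. x \<in> \<Omega> \<Longrightarrow> f differentiable (at x)" using Ck_closure_differentiable[OF f assms(2)] .
  show "\<exists>G. \<forall>i. continuous_on (closure \<Omega>) (G i) \<and> (\<forall>x\<in>\<Omega>. G i x = partial_deriv i f x)"
    using Ck_closure_partial_derivs[OF f] unfolding Ck_closure.simps(1) .
qed

lemma partial_deriv_bilinear:
  assumes B: "bounded_bilinear B" and f: "f differentiable (at x)" and g: "g differentiable (at x)"
  shows "partial_deriv i (\<lambda>y. B (f y) (g y)) x = B (f x) (partial_deriv i g x) + B (partial_deriv i f x) (g x)"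
  using has_partial_deriv[OF bounded_bilinear.FDERIV[OF B f[unfolded frechet_derivative_works] g[unfolded frechet_derivative_works]], of i]
  by (simp add: partial_deriv_def)

lemma C1_closure_bilinear:
  assumes B: "bounded_bilinear B" and "open \<Omega>" "Ck_closure 1 \<Omega> f" "Ck_closure 1 \<Omega> g"
  shows "Ck_closure 1 \<Omega> (\<lambda>x. B (f x) (g x))"
proof -
  note f = C1_closureD[OF assms(3,2)] and g = C1_closureD[OF assms(4,2)]
  obtain Df where Df: "\<forall>i. continuous_on (closure \<Omega>) (Df i) \<and> (\<forall>x\<in>\<Omega>. Df i x = partial_deriv i f x)"
    using f(3) by (rule exE)
  obtain Dg where Dg: "\<forall>i. continuous_on (closure \<Omega>) (Dg i) \<and> (\<forall>x\<in>\<Omega>. Dg i x = partial_deriv i g x)"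
    using g(3) by (rule exE)
  show ?thesis
  proof (rule C1_closureI[OF _ assms(2)])
    show "continuous_on (closure \<Omega>) (\<lambda>x. B (f x) (g x))" by (intro bounded_bilinear.continuous_on[OF B] f g)
    show "continuous_on (closure \<Omega>) (\<lambda>x. B (f x) (Dg i x) + B (Df i x) (g x))" for i
      by (intro bounded_bilinear.continuous_on[OF B] continuous_on_add f g) (use Df Dg in simp_all)
    show "(\<lambda>x. B (f x) (g x)) differentiable (at x)" if "x \<in> \<Omega>" for x
      using f(2)[OF that] g(2)[OF that] bounded_bilinear.FDERIV[OF B] unfolding differentiable_def by blast
    show "partial_deriv i (\<lambda>y. B (f y) (g y)) x = B (f x) (Dg i x) + B (Df i x) (g x)" if "x \<in> \<Omega>" for i x
      using partial_deriv_bilinear[OF B f(2)[OF that] g(2)[OF that]] Df Dg that by simp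
  qed
qed

lemmas partial_deriv_scaleR = partial_deriv_bilinear[OF bounded_bilinear_scaleR]
  and partial_deriv_inner = partial_deriv_bilinear[OF bounded_bilinear_inner]
  and C1_closure_scaleR = C1_closure_bilinear[OF bounded_bilinear_scaleR]
  and C1_closure_inner = C1_closure_bilinear[OF bounded_bilinear_inner]

lemma C1_closure_const: "open \<Omega> \<Longrightarrow> Ck_closure 1 \<Omega> (\<lambda>x. c)"
  by (rule C1_closureI[of _ _ "\<lambda>i x. 0"]) (auto simp: has_partial_deriv[OF has_derivative_const])

lemma partial_deriv_add:
  assumes "f differentiable (at x)" "g differentiable (at x)"
  shows "partial_deriv i (\<lambda>y. f y + g y) x = partial_deriv i f x + partial_deriv i g x"
  using has_partial_deriv[OF has_derivative_add[OF assms[unfolded frechet_derivative_works]], of i]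
  by (simp add: partial_deriv_def)

lemma partial_deriv_cmul:
  assumes "f differentiable (at x)"
  shows "partial_deriv i (\<lambda>y. c *\<^sub>R f y) x = c *\<^sub>R partial_deriv i f x"
  using has_partial_deriv[OF has_derivative_scaleR_right[OF assms[unfolded frechet_derivative_works]], of i]
  by (simp add: partial_deriv_def)

lemma C1_closure_add:
  assumes "open \<Omega>" "Ck_closure 1 \<Omega> f" "Ck_closure 1 \<Omega> g"
  shows "Ck_closure 1 \<Omega> (\<lambda>x. f x + g x)"
proof -
  note f = C1_closureD[OF assms(2,1)] and g = C1_closureD[OF assms(3,1)]
  obtain Df where Df: "\<forall>i. continuous_on (closure \<Omega>) (Df i) \<and> (\<forall>x\<in>\<Omega>. Df i x = partial_deriv i f x)"
    using f(3) by (rule exE)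
  obtain Dg where Dg: "\<forall>i. continuous_on (closure \<Omega>) (Dg i) \<and> (\<forall>x\<in>\<Omega>. Dg i x = partial_deriv i g x)"
    using g(3) by (rule exE)
  show ?thesis
  proof (rule C1_closureI[OF _ assms(1)])
    show "continuous_on (closure \<Omega>) (\<lambda>x. f x + g x)" by (intro continuous_on_add f g)
    show "continuous_on (closure \<Omega>) (\<lambda>x. Df i x + Dg i x)" for i
      by (intro continuous_on_add) (use Df Dg in simp_all)
    show "(\<lambda>x. f x + g x) differentiable (at x)" if "x \<in> \<Omega>" for x
      by (intro differentiable_add f g that)
    show "partial_deriv i (\<lambda>y. f y + g y) x = Df i x + Dg i x" if "x \<in> \<Omega>" for i x
      using partial_deriv_add[OF f(2)[OF that] g(2)[OF that]] Df Dg that by simp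
  qed
qed

lemma C1_closure_cmul: "open \<Omega> \<Longrightarrow> Ck_closure 1 \<Omega> f \<Longrightarrow> Ck_closure 1 \<Omega> (\<lambda>x. c *\<^sub>R f x)"
  by (intro C1_closure_scaleR C1_closure_const)

lemma C1_closure_midpt:
  "open \<Omega> \<Longrightarrow> Ck_closure 1 \<Omega> (f n) \<Longrightarrow> Ck_closure 1 \<Omega> (f (Suc n)) \<Longrightarrow> Ck_closure 1 \<Omega> (midpt f n)"
  unfolding midpt_def[abs_def] by (intro C1_closure_cmul C1_closure_add)

lemma C1_closure_vec:
  fixes f :: "'d::finite \<Rightarrow> real ^ 'd \<Rightarrow> real"
  assumes "open \<Omega>" "\<And>j. Ck_closure 1 \<Omega> (f j)"
  shows "Ck_closure 1 \<Omega> (\<lambda>x. \<chi> j. f j x)"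
proof -
  have partial_sums: "Ck_closure 1 \<Omega> (\<lambda>x. \<Sum>j\<in>J. f j x *\<^sub>R axis j (1::real))" for J
    by (induction J rule: infinite_finite_induct)
       (simp_all add: C1_closure_const C1_closure_add C1_closure_scaleR assms del: One_nat_def Ck_closure.simps)
  have expansion: "(\<Sum>j\<in>UNIV. f j x *\<^sub>R axis j 1) = (\<chi> j. f j x)" for x
    by (simp add: vec_eq_iff axis_def if_distrib cong: if_cong)
  show ?thesis using partial_sums[of UNIV] unfolding expansion .
qed

lemma differentiable_vec_nth: "u differentiable F \<Longrightarrow> (\<lambda>y. u y $ i) differentiable F"
  unfolding differentiable_def using bounded_linear.has_derivative[OF bounded_linear_vec_nth] by blast

lemma partial_deriv_cong_open:
  assumes "open \<Omega>" "x \<in> \<Omega>" "f differentiable (at x)" "\<And>y. y \<in> \<Omega> \<Longrightarrow> f y = g y"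
  shows "partial_deriv i f x = partial_deriv i g x"
  unfolding partial_deriv_def using frechet_derivative_transform_within_open[OF assms(3,1,2,4)] by simp

lemma divergence_scaleR:
  assumes "f differentiable (at x)" "F differentiable (at x)"
  shows "divergence (\<lambda>y. f y *\<^sub>R F y) x = f x * divergence F x + grad f x \<bullet> F x"
proof -
  have "(\<lambda>y. f y *\<^sub>R F y) differentiable (at x)"
    using assms by (rule differentiable_scaleR)
  then show ?thesis
    by (simp add: divergence_eq_sum_partial_deriv assms partial_deriv_scaleR grad_def inner_vec_def
        sum.distrib sum_distrib_left)
qed

lemma divergence_add:
  assumes "F differentiable (at x)" "H differentiable (at x)"
  shows "divergence (\<lambda>y. F y + H y) x = divergence F x + divergence H x"
  using assms by (simp add: divergence_eq_sum_partial_deriv differentiable_add partial_deriv_add sum.distrib)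

lemma divergence_cmul:
  assumes "F differentiable (at x)"
  shows "divergence (\<lambda>y. c *\<^sub>R F y) x = c * divergence F x"
  using assms by (simp add: divergence_eq_sum_partial_deriv differentiable_scaleR partial_deriv_cmul sum_distrib_left)

section \<open>Integration over bounded open sets\<close>

lemma set_integrable_bounded_continuous:
  fixes f :: "'a::euclidean_space \<Rightarrow> real"
  assumes "open \<Omega>" "bounded \<Omega>" "continuous_on \<Omega> f" "\<And>x. x \<in> \<Omega> \<Longrightarrow> \<bar>f x\<bar> \<le> M"
  shows "set_integrable lborel \<Omega> f"
proof -
  have m: "set_borel_measurable lborel \<Omega> f"
    using borel_measurable_continuous_on_indicator[of \<Omega> f] assms(1,3)
    by (simp add: set_borel_measurable_def)
  have "emeasure lborel \<Omega> < \<infinity>"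
    by (rule emeasure_bounded_finite[OF assms(2)])
  then have i: "set_integrable lborel \<Omega> (\<lambda>x. M)"
    using assms(1) unfolding set_integrable_def by (simp add: integrable_real_indicator)
  show ?thesis
    by (rule set_integrable_bound[OF i m]) (use assms(4) in force)
qed

lemma set_integral_le_measure:
  fixes f :: "'a::euclidean_space \<Rightarrow> real"
  assumes f: "set_integrable lborel \<Omega> f" and L: "L \<in> sets borel" "bounded L" and M: "0 \<le> M"
    and "\<And>x. x \<in> \<Omega> \<Longrightarrow> x \<in> L \<Longrightarrow> \<bar>f x\<bar> \<le> M" "\<And>x. x \<in> \<Omega> \<Longrightarrow> x \<notin> L \<Longrightarrow> f x = 0"
  shows "\<bar>LINT x:\<Omega>|lborel. f x\<bar> \<le> M * measure lebesgue L"
proof -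
  have fin: "emeasure lborel L < \<infinity>"
    by (rule emeasure_bounded_finite[OF L(2)])
  have "\<bar>LINT x:\<Omega>|lborel. f x\<bar> \<le> (\<integral>x. M * indicat_real L x \<partial>lborel)"
    unfolding set_lebesgue_integral_def real_norm_def[symmetric]
  proof (rule Bochner_Integration.integral_norm_bound_integral)
    show "integrable lborel (\<lambda>x. indicat_real \<Omega> x *\<^sub>R f x)"
      using f by (simp add: set_integrable_def)
    show "integrable lborel (\<lambda>x. M * indicat_real L x)"
      using L fin by (simp add: integrable_real_indicator)
    show "norm (indicat_real \<Omega> x *\<^sub>R f x) \<le> M * indicat_real L x" for x
      using assms by (auto simp: indicator_def)
  qed
  also have "\<dots> = M * measure lebesgue L"
    using L fin by simp
  finally show ?thesis .
qed

text \<open>Difference quotients of a compactly supported function integrate to zero, because Lebesgue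
  measure is translation invariant. They converge to the derivative, dominated by its maximum on a ball.\<close>

lemma integral_directional_derivative_eq_0:
  fixes f :: "'a::euclidean_space \<Rightarrow> real"
  assumes f: "\<And>x. (f has_derivative f' x) (at x)"
    and cont: "continuous_on UNIV (\<lambda>x. f' x e)"
    and K: "compact K" "\<And>x. x \<notin> K \<Longrightarrow> f x = 0"
  shows "(\<integral>x. f' x e \<partial>lborel) = 0"
proof -
  define d where "d x = f' x e" for x
  define s :: "nat \<Rightarrow> real" where "s n = 1 / real (Suc n)" for n
  have s: "0 < s n" "s n \<le> 1" for n by (auto simp: s_def)
  have s0: "s \<longlonglongrightarrow> 0" unfolding s_def by (rule LIMSEQ_Suc[OF lim_1_over_n])
  have d0: "d x = 0" if "x \<notin> K" for x
  proof -
    have "(f has_derivative (\<lambda>h. 0)) (at x)"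
      by (rule has_derivative_transform_within_open[where f = "\<lambda>x. 0" and s = "- K"])
         (use K that in \<open>auto simp: compact_imp_closed open_Compl\<close>)
    then have "f' x = (\<lambda>h. 0)" using f has_derivative_unique by blast
    then show ?thesis by (simp add: d_def)
  qed
  obtain R where R: "\<And>x. x \<in> K \<Longrightarrow> norm x \<le> R"
    using K(1) compact_imp_bounded bounded_iff by metis
  have "compact (d ` K)"
    using K(1) cont by (intro compact_continuous_image) (auto simp: d_def[abs_def] intro: continuous_on_subset)
  then obtain M0 where M0: "\<And>x. x \<in> K \<Longrightarrow> \<bar>d x\<bar> \<le> M0"
    using compact_imp_bounded bounded_iff by (metis image_eqI real_norm_def)
  define M where "M = max M0 0"
  have M: "\<bar>d x\<bar> \<le> M" for x
    using M0[of x] d0[of x] by (cases "x \<in> K") (auto simp: M_def)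
  have line: "\<bar>f (x + h *\<^sub>R e) - f x\<bar> \<le> M * h" if "h > 0" for x h
  proof -
    have "((\<lambda>t. f (x + t *\<^sub>R e)) has_derivative (\<lambda>u. f' (x + t *\<^sub>R e) (u *\<^sub>R e))) (at t)" for t
      by (rule has_derivative_compose[of "\<lambda>t. x + t *\<^sub>R e" "\<lambda>u. u *\<^sub>R e" t UNIV f "f' (x + t *\<^sub>R e)"])
         (auto intro!: derivative_eq_intros f)
    moreover have "f' y (u *\<^sub>R e) = d y * u" for y u
      using linear_scale[OF has_derivative_linear[OF f[of y]], of u e] by (simp add: d_def)
    ultimately have "((\<lambda>t. f (x + t *\<^sub>R e)) has_real_derivative d (x + t *\<^sub>R e)) (at t)" for t
      by (simp add: has_field_derivative_def)
    from MVT2[of 0 h "\<lambda>t. f (x + t *\<^sub>R e)", OF that this]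
    obtain z where "f (x + h *\<^sub>R e) - f (x + 0 *\<^sub>R e) = (h - 0) * d (x + z *\<^sub>R e)" by blast
    then show ?thesis using M[of "x + z *\<^sub>R e"] that by (simp add: abs_mult mult.commute)
  qed
  have contf: "continuous_on UNIV f"
    using f by (meson continuous_at_imp_continuous_on has_derivative_continuous)
  have intf: "integrable lborel f"
  proof -
    have "integrable lborel (\<lambda>x. indicator K x *\<^sub>R f x)"
      using K(1) contf continuous_on_subset by (intro borel_integrable_compact) blast+
    moreover have "(\<lambda>x. indicator K x *\<^sub>R f x) = f"
      using K(2) by (auto simp: indicator_def fun_eq_iff)
    ultimately show ?thesis by simp
  qed
  have transl: "integrable lborel (\<lambda>x. f (x + a)) \<and> (\<integral>x. f (x + a) \<partial>lborel) = (\<integral>x. f x \<partial>lborel)" for a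
  proof -
    have d: "distr lborel borel ((+) a) = (lborel :: 'a measure)"
      by (rule lborel_distr_plus)
    have m: "(+) a \<in> measurable lborel (borel :: 'a measure)" by simp
    have "integrable (distr lborel borel ((+) a)) f" using intf d by simp
    then have "integrable lborel (\<lambda>x. f (a + x))" by (rule integrable_distr[OF m])
    moreover have "integral\<^sup>L (distr lborel borel ((+) a)) f = (\<integral>x. f (a + x) \<partial>lborel)"
      using intf by (intro integral_distr[OF m]) simp
    ultimately show ?thesis using d by (simp add: add.commute)
  qed
  define D where "D n x = (f (x + s n *\<^sub>R e) - f x) / s n" for n x
  have "(\<lambda>n. \<integral>x. D n x \<partial>lborel) \<longlonglongrightarrow> (\<integral>x. d x \<partial>lborel)"
  proof (rule integral_dominated_convergence[where w = "\<lambda>x. M * indicator (cball 0 (R + norm e)) x"])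
    show "d \<in> borel_measurable lborel"
      using cont by (simp add: d_def[abs_def] borel_measurable_continuous_onI)
    show "D n \<in> borel_measurable lborel" for n
    proof -
      have "continuous_on UNIV (\<lambda>x. f (x + s n *\<^sub>R e))"
        by (rule continuous_on_compose2[OF contf]) (auto intro!: continuous_intros)
      then have "continuous_on UNIV (D n)"
        unfolding D_def[abs_def] using s(1)[of n] by (intro continuous_intros contf) auto
      then show ?thesis by (simp add: borel_measurable_continuous_onI)
    qed
    show "integrable lborel (\<lambda>x. M * indicator (cball 0 (R + norm e)) x :: real)"
      by (intro integrable_mult_right integrable_real_indicator emeasure_bounded_finite) auto
    show "AE x in lborel. norm (D n x) \<le> M * indicator (cball 0 (R + norm e)) x" for n
    proof (rule AE_I2)
      fix x
      show "norm (D n x) \<le> M * indicator (cball 0 (R + norm e)) x"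
      proof (cases "norm x \<le> R + norm e")
        case True
        then show ?thesis
          using line[OF s(1)[of n], of x] s(1)[of n] by (simp add: D_def divide_simps mult.commute)
      next
        case False
        have "norm x \<le> norm (x + s n *\<^sub>R e) + norm (s n *\<^sub>R e)"
          by (metis add_diff_cancel_right' norm_triangle_ineq4)
        moreover have "norm (s n *\<^sub>R e) \<le> norm e"
          using s[of n] by (simp add: mult_left_le_one_le)
        ultimately have "x + s n *\<^sub>R e \<notin> K" using False R[of "x + s n *\<^sub>R e"] by linarith
        moreover have "x \<notin> K" using False R[of x] norm_ge_zero[of e] by linarith
        ultimately show ?thesis using False K(2) by (simp add: D_def)
      qed
    qed
    show "AE x in lborel. (\<lambda>n. D n x) \<longlonglongrightarrow> d x"
    proof (rule AE_I2)
      fix x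
      have "((\<lambda>t. f (x + t *\<^sub>R e)) has_derivative (\<lambda>u. f' x (u *\<^sub>R e))) (at 0)"
        by (rule has_derivative_compose[of "\<lambda>t. x + t *\<^sub>R e" "\<lambda>u. u *\<^sub>R e" 0 UNIV f "f' x"])
         (use f[of x] in \<open>auto intro!: derivative_eq_intros\<close>)
      moreover have "f' x (u *\<^sub>R e) = d x * u" for u
        using linear_scale[OF has_derivative_linear[OF f[of x]], of u e] by (simp add: d_def)
      ultimately have "((\<lambda>t. f (x + t *\<^sub>R e)) has_real_derivative d x) (at 0)"
        by (simp add: has_field_derivative_def)
      then have "((\<lambda>h. (f (x + h *\<^sub>R e) - f x) / h) \<longlongrightarrow> d x) (at 0)"
        by (simp add: has_field_derivative_iff)
      moreover have "filterlim s (at 0) sequentially"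
        using s0 s(1) by (auto simp: filterlim_at eventually_sequentially intro!: less_imp_neq[symmetric])
      ultimately show "(\<lambda>n. D n x) \<longlonglongrightarrow> d x"
        unfolding D_def by (rule filterlim_compose)
    qed
  qed
  moreover have "(\<integral>x. D n x \<partial>lborel) = 0" for n
    using transl[of "s n *\<^sub>R e"] intf by (simp add: D_def)
  ultimately have "(\<integral>x. d x \<partial>lborel) = 0"
    by (simp add: LIMSEQ_const_iff)
  then show ?thesis by (simp add: d_def)
qed

lemma continuous_on_closure_bounded:
  fixes f :: "'a::euclidean_space \<Rightarrow> 'b::real_normed_vector"
  assumes "bounded \<Omega>" "continuous_on (closure \<Omega>) f"
  shows "\<exists>M\<ge>0. \<forall>x\<in>closure \<Omega>. norm (f x) \<le> M"
proof -
  have "compact (closure \<Omega>)" using assms(1) by (simp add: compact_closure)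
  then have "bounded (f ` closure \<Omega>)"
    by (intro compact_imp_bounded compact_continuous_image assms(2))
  then obtain M where "\<forall>x\<in>closure \<Omega>. norm (f x) \<le> M" unfolding bounded_iff by blast
  then show ?thesis by (intro exI[of _ "max M 0"]) (auto simp: le_max_iff_disj)
qed

lemma set_integrable_continuous_closure:
  fixes f :: "'a::euclidean_space \<Rightarrow> real"
  assumes "open \<Omega>" "bounded \<Omega>" "continuous_on (closure \<Omega>) g" "\<And>x. x \<in> \<Omega> \<Longrightarrow> f x = g x"
  shows "set_integrable lborel \<Omega> f"
proof -
  obtain M where M: "\<forall>x\<in>closure \<Omega>. norm (g x) \<le> M"
    using continuous_on_closure_bounded[OF assms(2,3)] by auto
  have "set_integrable lborel \<Omega> g"
  proof (rule set_integrable_bounded_continuous[OF assms(1,2)])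
    show "continuous_on \<Omega> g" by (rule continuous_on_subset[OF assms(3) closure_subset])
    show "\<bar>g x\<bar> \<le> M" if "x \<in> \<Omega>" for x using M that closure_subset[of \<Omega>] by auto
  qed
  moreover have "set_integrable lborel \<Omega> f \<longleftrightarrow> set_integrable lborel \<Omega> g"
    by (rule set_integrable_cong) (use assms(4) in auto)
  ultimately show ?thesis by blast
qed

section \<open>Cutoff functions\<close>

definition sq_pos :: "real \<Rightarrow> real" where "sq_pos s = (max 0 s)\<^sup>2"

lemma has_real_derivative_sq_pos: "(sq_pos has_real_derivative 2 * max 0 s) (at s)"
proof -
  consider "s < 0" | "s = 0" | "s > 0" by linarith
  then show ?thesis
  proof cases
    case 1
    have "(sq_pos has_real_derivative 0) (at s)"
      by (rule has_field_derivative_transform_within_open[where f = "\<lambda>s. 0" and S = "{..<0}"])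
         (use 1 in \<open>auto simp: sq_pos_def max_def\<close>)
    then show ?thesis using 1 by simp
  next
    case 2
    have "(\<lambda>h. (sq_pos (0 + h) - sq_pos 0) / h) \<midarrow>0\<rightarrow> 0"
    proof (rule Lim_null_comparison)
      show "\<forall>\<^sub>F h in at 0. norm ((sq_pos (0 + h) - sq_pos 0) / h) \<le> \<bar>h\<bar>"
        by (rule always_eventually) (auto simp: sq_pos_def max_def power2_eq_square)
    qed (auto intro!: tendsto_eq_intros)
    then show ?thesis using 2 by (simp add: has_field_derivative_iff)
  next
    case 3
    have "(sq_pos has_real_derivative 2 * s) (at s)"
      by (rule has_field_derivative_transform_within_open[where f = "\<lambda>s. s\<^sup>2" and S = "{0<..}"])
         (use 3 in \<open>auto simp: sq_pos_def max_def intro!: derivative_eq_intros\<close>)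
    then show ?thesis using 3 by simp
  qed
qed

text \<open>A \<open>C\<^sup>1\<close> transition from \<open>0\<close> (for arguments up to \<open>1\<close>) to \<open>1\<close> (from \<open>2\<close> on), made of two truncated
  parabolas.\<close>

definition c1_step :: "real \<Rightarrow> real" where "c1_step s = sq_pos (1 - sq_pos (2 - s))"

definition c1_step' :: "real \<Rightarrow> real"
  where "c1_step' s = 4 * max 0 (1 - sq_pos (2 - s)) * max 0 (2 - s)"

lemma has_real_derivative_c1_step: "(c1_step has_real_derivative c1_step' s) (at s)"
proof -
  have "((\<lambda>s. sq_pos (2 - s)) has_real_derivative (2 * max 0 (2 - s)) * (- 1)) (at s)"
    by (rule DERIV_chain2[OF has_real_derivative_sq_pos]) (auto intro!: derivative_eq_intros)
  then have "((\<lambda>s. 1 - sq_pos (2 - s)) has_real_derivative 2 * max 0 (2 - s)) (at s)"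
    by (auto intro!: derivative_eq_intros)
  from DERIV_chain2[OF has_real_derivative_sq_pos this]
  show ?thesis unfolding c1_step_def[abs_def] c1_step'_def by (simp add: ac_simps)
qed

lemma continuous_on_c1_step': "continuous_on A c1_step'"
proof -
  have "continuous_on UNIV sq_pos"
    using has_real_derivative_sq_pos by (meson DERIV_isCont continuous_at_imp_continuous_on)
  then have "continuous_on A (\<lambda>s. sq_pos (2 - s))"
    by (rule continuous_on_compose2) (auto intro!: continuous_intros)
  then show ?thesis unfolding c1_step'_def[abs_def] by (intro continuous_intros)
qed

lemma c1_step_eq_0: "s \<le> 1 \<Longrightarrow> c1_step s = 0" and c1_step_eq_1: "2 \<le> s \<Longrightarrow> c1_step s = 1"
  and c1_step_range: "0 \<le> c1_step s" "c1_step s \<le> 1"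
proof -
  show "c1_step s = 0" if "s \<le> 1"
  proof -
    have "1 \<le> (2 - s)\<^sup>2" using that power_mono[of 1 "2 - s" 2] by simp
    then have "1 - sq_pos (2 - s) \<le> 0" using that by (simp add: sq_pos_def max_def)
    then show ?thesis by (simp add: c1_step_def sq_pos_def[of "1 - _"])
  qed
  show "c1_step s = 1" if "2 \<le> s" using that by (simp add: c1_step_def sq_pos_def max_def)
  show "0 \<le> c1_step s" by (simp add: c1_step_def sq_pos_def)
  have "max 0 (1 - sq_pos (2 - s)) \<le> 1" by (simp add: sq_pos_def)
  then show "c1_step s \<le> 1"
    using power_mono[of "max 0 (1 - sq_pos (2 - s))" 1 2] by (simp add: c1_step_def sq_pos_def)
qed

lemma c1_step'_eq_0: "s \<le> 1 \<or> 2 \<le> s \<Longrightarrow> c1_step' s = 0"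
  and c1_step'_bound: "\<bar>c1_step' s\<bar> \<le> 4"
proof -
  have le: "sq_pos (2 - s) \<ge> 1" if "s \<le> 1"
    using that power_mono[of 1 "2 - s" 2] by (simp add: sq_pos_def max_def)
  show "c1_step' s = 0" if "s \<le> 1 \<or> 2 \<le> s"
    using that le by (auto simp: c1_step'_def max_def)
  show "\<bar>c1_step' s\<bar> \<le> 4"
  proof (cases "s \<le> 1")
    case True
    then show ?thesis using le by (simp add: c1_step'_def max_def)
  next
    case False
    have "max 0 (1 - sq_pos (2 - s)) * max 0 (2 - s) \<le> 1 * 1"
      using False by (intro mult_mono) (auto simp: sq_pos_def)
    moreover have "0 \<le> max 0 (1 - sq_pos (2 - s)) * max 0 (2 - s)" by simp
    ultimately show ?thesis unfolding c1_step'_def by (simp add: abs_mult mult.assoc)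
  qed
qed

text \<open>The gradient is carried along as a separate function, so that products and differences come with
  explicit gradients.\<close>

definition test_function :: "('a::euclidean_space \<Rightarrow> real) \<Rightarrow> ('a \<Rightarrow> 'a) \<Rightarrow> bool"
  where "test_function \<phi> D \<longleftrightarrow>
    (\<forall>x. (\<phi> has_derivative (\<lambda>h. D x \<bullet> h)) (at x)) \<and> continuous_on UNIV D"

lemma test_function_continuous: "test_function \<phi> D \<Longrightarrow> continuous_on A \<phi>"
  unfolding test_function_def
  by (meson continuous_at_imp_continuous_on has_derivative_continuous)

lemma test_function_gradient_continuous: "test_function \<phi> D \<Longrightarrow> continuous_on A D"
  unfolding test_function_def using continuous_on_subset by blast

lemma test_function_gradient_eq_0:
  assumes "test_function \<phi> D" "open A" "x \<in> A" "\<And>y. y \<in> A \<Longrightarrow> \<phi> y = c"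
  shows "D x = 0"
proof -
  have "(\<phi> has_derivative (\<lambda>h. 0)) (at x)"
    by (rule has_derivative_transform_within_open[where f = "\<lambda>x. c" and s = A]) (use assms in auto)
  then have "(\<lambda>h. D x \<bullet> h) = (\<lambda>h. 0)"
    using assms(1) has_derivative_unique unfolding test_function_def by blast
  then have "D x \<bullet> D x = 0" by meson
  then show ?thesis by simp
qed

lemma test_function_const: "test_function (\<lambda>x. c) (\<lambda>x. 0)"
  by (simp add: test_function_def)

lemma test_function_diff:
  "test_function \<phi> D \<Longrightarrow> test_function \<psi> E \<Longrightarrow> test_function (\<lambda>x. \<phi> x - \<psi> x) (\<lambda>x. D x - E x)"
  unfolding test_function_def
  by (auto intro!: derivative_eq_intros continuous_intros simp: inner_diff_left)

lemma test_function_mult: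
  "test_function \<phi> D \<Longrightarrow> test_function \<psi> E \<Longrightarrow>
    test_function (\<lambda>x. \<phi> x * \<psi> x) (\<lambda>x. \<phi> x *\<^sub>R E x + \<psi> x *\<^sub>R D x)"
  using test_function_continuous[of \<phi> D UNIV] test_function_continuous[of \<psi> E UNIV]
  unfolding test_function_def
  by (auto intro!: derivative_eq_intros continuous_intros simp: inner_add_left)

text \<open>The bump is a function of the squared distance, which is smooth also at the centre. The
  factor \<open>1 / r\<close> in the gradient bound is the scaling that the removal of the singular boundary relies on.\<close>

lemma bump_test_function:
  fixes z :: "'a::euclidean_space"
  assumes "0 < r"
  shows "\<exists>b D. test_function b D \<and> (\<forall>x. 0 \<le> b x \<and> b x \<le> 1 \<and> norm (D x) \<le> 16 / r) \<and>
    (\<forall>x\<in>ball z r. b x = 1) \<and> (\<forall>x. x \<notin> ball z (2 * r) \<longrightarrow> b x = 0 \<and> D x = 0)"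
proof -
  \<comment> \<open>At distance \<open>r\<close> from \<open>z\<close> this equals \<open>2\<close>, and from distance \<open>2 r\<close> on it is at most \<open>-1\<close>, so it
      passes through the transition range of \<^const>\<open>c1_step\<close>.\<close>
  define u where "u x = 3 - ((x - z) \<bullet> (x - z)) / r\<^sup>2" for x
  define b where "b x = c1_step (u x)" for x
  define D where "D x = (- 2 * c1_step' (u x) / r\<^sup>2) *\<^sub>R (x - z)" for x
  have u_eq: "u x = 3 - (dist z x / r)\<^sup>2" for x
    by (simp add: u_def power2_norm_eq_inner[symmetric] dist_norm norm_minus_commute power_divide)
  have near: "2 \<le> u x" if "x \<in> ball z r" for x
  proof -
    have "(dist z x / r)\<^sup>2 \<le> 1\<^sup>2" using that assms by (intro power_mono) auto
    then show ?thesis by (simp add: u_eq)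
  qed
  have far: "u x \<le> 1" if "x \<notin> ball z (2 * r)" for x
  proof -
    have "2\<^sup>2 \<le> (dist z x / r)\<^sup>2" using that assms by (intro power_mono) (auto simp: field_simps)
    then show ?thesis by (simp add: u_eq)
  qed
  have "(b has_derivative (\<lambda>h. D x \<bullet> h)) (at x)" for x
  proof -
    have "(u has_derivative (\<lambda>h. - (2 * ((x - z) \<bullet> h) / r\<^sup>2))) (at x)"
      unfolding u_def using assms
      by (auto intro!: derivative_eq_intros simp: inner_commute field_simps)
    from has_derivative_compose[OF this has_real_derivative_c1_step[unfolded has_field_derivative_def]]
    show ?thesis unfolding b_def D_def by (simp add: ac_simps)
  qed
  moreover have "continuous_on UNIV D"
    unfolding D_def[abs_def] u_def using assms
    by (intro continuous_intros continuous_on_compose2[OF continuous_on_c1_step'[of UNIV]]) auto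
  ultimately have T: "test_function b D" by (simp add: test_function_def)
  have D0: "D x = 0" if "x \<notin> ball z (2 * r)" for x
    using far[OF that] by (simp add: D_def c1_step'_eq_0)
  have "norm (D x) \<le> 16 / r" for x
  proof (cases "x \<in> ball z (2 * r)")
    case True
    have "norm (D x) = 2 * \<bar>c1_step' (u x)\<bar> / r\<^sup>2 * norm (x - z)"
      using assms by (simp add: D_def abs_mult)
    also have "\<dots> \<le> 2 * 4 / r\<^sup>2 * (2 * r)"
      using True c1_step'_bound[of "u x"] assms
      by (intro mult_mono divide_right_mono) (auto simp: dist_norm norm_minus_commute)
    also have "\<dots> = 16 / r" using assms by (simp add: power2_eq_square)
    finally show ?thesis .
  qed (use D0 assms in simp)
  then show ?thesis
    using T D0 near far c1_step_range
    by (intro exI[of _ b] exI[of _ D]) (auto simp: b_def c1_step_eq_1 c1_step_eq_0)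
qed

section \<open>Green's formula tested with functions supported inside the domain\<close>

text \<open>The integral of the divergence of \<open>\<phi> F\<close> after the product rule; \<open>D\<close> stands for the gradient of \<open>\<phi>\<close>.\<close>

definition green_form ::
    "(real ^ 'd) set \<Rightarrow> (real ^ 'd \<Rightarrow> real ^ 'd) \<Rightarrow> (real ^ 'd \<Rightarrow> real) \<Rightarrow> (real ^ 'd \<Rightarrow> real ^ 'd) \<Rightarrow> real"
  where "green_form \<Omega> F \<phi> D = (LINT x:\<Omega>|lborel. \<phi> x * divergence F x + F x \<bullet> D x)"

context
  fixes \<Omega> :: "(real ^ 'd) set" and F :: "real ^ 'd \<Rightarrow> real ^ 'd"
  assumes domain: "open \<Omega>" "bounded \<Omega>" and F: "Ck_closure 1 \<Omega> F"
begin

lemma C1_field_differentiable: "x \<in> \<Omega> \<Longrightarrow> F differentiable (at x)"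
  using Ck_closure_differentiable[of 0 \<Omega> F x] domain(1) F by simp

lemma C1_field_continuous: "continuous_on (closure \<Omega>) F" using F by simp

lemma green_form_integrable:
  assumes "test_function \<phi> D"
  shows "set_integrable lborel \<Omega> (\<lambda>x. \<phi> x * divergence F x + F x \<bullet> D x)"
proof -
  obtain d where d: "continuous_on (closure \<Omega>) d" "\<forall>x\<in>\<Omega>. d x = divergence F x"
    using divergence_extends_continuously[OF domain(1) F] by (elim exE conjE)
  show ?thesis
  proof (rule set_integrable_continuous_closure[OF domain])
    show "continuous_on (closure \<Omega>) (\<lambda>x. \<phi> x * d x + F x \<bullet> D x)"
      by (intro continuous_intros d C1_field_continuous test_function_continuous[OF assms]
            test_function_gradient_continuous[OF assms])
  qed (simp add: d)
qed

lemma green_form_cong: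
  assumes "\<And>x. x \<in> \<Omega> \<Longrightarrow> \<phi> x = \<psi> x" "test_function \<phi> D" "test_function \<psi> E"
  shows "green_form \<Omega> F \<phi> D = green_form \<Omega> F \<psi> E"
proof -
  have "D x - E x = 0" if "x \<in> \<Omega>" for x
    by (rule test_function_gradient_eq_0[OF test_function_diff[OF assms(2,3)] domain(1) that, of 0])
       (simp add: assms(1))
  then have "\<phi> x * divergence F x + F x \<bullet> D x = \<psi> x * divergence F x + F x \<bullet> E x" if "x \<in> \<Omega>" for x
    using assms(1)[OF that] that by (simp only: right_minus_eq)
  then show ?thesis
    using domain(1) unfolding green_form_def by (intro set_lebesgue_integral_cong) auto
qed

lemma green_form_diff:
  assumes "test_function \<phi> D" "test_function \<psi> E"
  shows "green_form \<Omega> F (\<lambda>x. \<phi> x - \<psi> x) (\<lambda>x. D x - E x) = green_form \<Omega> F \<phi> D - green_form \<Omega> F \<psi> E"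
  unfolding green_form_def
    set_integral_diff(2)[OF green_form_integrable[OF assms(1)] green_form_integrable[OF assms(2)], symmetric]
  by (simp add: algebra_simps)

text \<open>Extended by zero, \<open>\<phi> F\<close> is continuously differentiable on the whole space, so that each of its
  partial derivatives integrates to zero.\<close>

lemma green_form_compact_support:
  assumes \<phi>: "test_function \<phi> D" and K: "compact K" "K \<subseteq> \<Omega>" "\<And>x. x \<notin> K \<Longrightarrow> \<phi> x = 0"
  shows "green_form \<Omega> F \<phi> D = 0"
proof -
  have K': "open (- K)" "\<Omega> \<union> - K = UNIV" using K by (auto simp: compact_imp_closed open_Compl)
  have D0: "D x = 0" if "x \<notin> K" for x
    using test_function_gradient_eq_0[OF \<phi> K'(1), of x 0] K(3) that by auto
  define f where "f i x = (if x \<in> \<Omega> then \<phi> x * F x $ i else 0)" for i x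
  define f' where "f' i x h = (if x \<in> \<Omega> then \<phi> x * frechet_derivative F (at x) h $ i + (D x \<bullet> h) * F x $ i else 0)"
    for i x h
  define d where "d i x = f' i x (axis i 1)" for i x
  have d_eq: "d i x = \<phi> x * partial_deriv i F x $ i + D x $ i * F x $ i" if "x \<in> \<Omega>" for i x
    using that by (simp add: d_def f'_def partial_deriv_def inner_axis)
  have d0: "d i x = 0" if "x \<notin> K" for i x
    using that K(3) D0 by (simp add: d_def f'_def)
  have deriv: "(f i has_derivative f' i x) (at x)" for i x
  proof (cases "x \<in> \<Omega>")
    case True
    have "((\<lambda>x. \<phi> x * F x $ i) has_derivative f' i x) (at x)"
      using True \<phi> C1_field_differentiable[OF True] unfolding f'_def[abs_def] test_function_def frechet_derivative_works
      by (auto intro!: derivative_eq_intros bounded_linear.has_derivative[OF bounded_linear_vec_nth])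
    then show ?thesis
      by (rule has_derivative_transform_within_open[OF _ domain(1) True]) (simp add: f_def)
  next
    case False
    have "((\<lambda>x. 0) has_derivative f' i x) (at x)"
      using False unfolding f'_def[abs_def] by simp
    then show ?thesis
      by (rule has_derivative_transform_within_open[OF _ K'(1)]) (use False K in \<open>auto simp: f_def\<close>)
  qed
  have cont: "continuous_on UNIV (d i)" for i
  proof -
    obtain G where G: "\<forall>i. Ck_closure 0 \<Omega> (G i) \<and> (\<forall>x\<in>\<Omega>. G i x = partial_deriv i F x)"
      using Ck_closure_partial_derivs[OF F[unfolded One_nat_def]] by (rule exE)
    have "continuous_on (closure \<Omega>) (G i)" using G by simp
    then have "continuous_on \<Omega> (G i)" "continuous_on \<Omega> F"
      using C1_field_continuous by (meson continuous_on_subset closure_subset)+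
    then have "continuous_on \<Omega> (\<lambda>x. \<phi> x * G i x $ i + D x $ i * F x $ i)"
      by (intro continuous_intros test_function_continuous[OF \<phi>] test_function_gradient_continuous[OF \<phi>])
    then have "continuous_on \<Omega> (d i)"
      by (rule continuous_on_eq) (simp add: d_eq G)
    moreover have "continuous_on (- K) (d i)"
      by (rule continuous_on_eq[OF continuous_on_const[of _ 0]]) (simp add: d0)
    ultimately show ?thesis using continuous_on_open_Un[OF domain(1) K'(1)] by (simp add: K'(2))
  qed
  have int: "integrable lborel (d i)" for i
  proof -
    have "integrable lborel (\<lambda>x. indicator K x *\<^sub>R d i x)"
      using K(1) cont continuous_on_subset by (intro borel_integrable_compact) blast+
    moreover have "(\<lambda>x. indicator K x *\<^sub>R d i x) = d i"
      using d0 by (auto simp: indicator_def fun_eq_iff)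
    ultimately show ?thesis by simp
  qed
  have "(\<integral>x. d i x \<partial>lborel) = 0" for i
    unfolding d_def
    by (rule integral_directional_derivative_eq_0[OF deriv _ K(1)])
       (use cont K(3) in \<open>auto simp: d_def[abs_def] f_def\<close>)
  then have "(\<integral>x. (\<Sum>i\<in>UNIV. d i x) \<partial>lborel) = 0"
    using int by (subst Bochner_Integration.integral_sum) auto
  moreover have "(\<Sum>i\<in>UNIV. d i x) = indicator \<Omega> x *\<^sub>R (\<phi> x * divergence F x + F x \<bullet> D x)" for x
  proof (cases "x \<in> \<Omega>")
    case True
    then show ?thesis
      using C1_field_differentiable[OF True]
      by (simp add: d_eq divergence_eq_sum_partial_deriv sum.distrib sum_distrib_left inner_vec_def mult.commute)
  next
    case False
    then show ?thesis using d0 K(2) by (auto intro!: sum.neutral)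
  qed
  ultimately show ?thesis unfolding green_form_def set_lebesgue_integral_def by simp
qed

end

section \<open>Geometry of the regular boundary\<close>

lemma sublevel_chart_frontier:
  fixes g :: "real ^ 'd \<Rightarrow> real"
  assumes "open \<Omega>" "open U" and g: "\<And>y. y \<in> U \<Longrightarrow> (g has_derivative (\<lambda>h. g' y \<bullet> h)) (at y)"
    and chart: "\<Omega> \<inter> U = {y \<in> U. g y < 0}" and x: "x \<in> frontier \<Omega>" "x \<in> U"
  shows "g x = 0"
proof -
  have "x \<notin> \<Omega>" using x(1) \<open>open \<Omega>\<close> by (simp add: frontier_def interior_open)
  then have "0 \<le> g x" using chart x(2) by fastforce
  moreover have "\<not> 0 < g x"
  proof
    assume "0 < g x"
    have "continuous_on U g"
      using g by (meson continuous_at_imp_continuous_on has_derivative_continuous)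
    then have "open (U \<inter> g -` {0<..})"
      using \<open>open U\<close> by (simp add: continuous_on_open_vimage Int_commute)
    moreover have "x \<in> U \<inter> g -` {0<..}" using x(2) \<open>0 < g x\<close> by simp
    moreover have "x \<in> closure \<Omega>" using x(1) by (simp add: frontier_def)
    ultimately have "\<Omega> \<inter> (U \<inter> g -` {0<..}) \<noteq> {}"
      by (metis Int_commute closure_iff_nhds_not_empty subset_refl)
    then obtain y where "y \<in> \<Omega>" "y \<in> U" "0 < g y" by auto
    moreover from this have "g y < 0" using chart by blast
    ultimately show False by simp
  qed
  ultimately show ?thesis by linarith
qed

text \<open>If two unit normals \<open>a\<close> and \<open>b\<close> differ, the direction \<open>b - a\<close> has negative product with \<open>a\<close>
  and positive product with \<open>b\<close>. It would point into the domain and out of it.\<close>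

lemma outward_unit_normal_unique:
  assumes "outward_unit_normal \<Omega> x a" "outward_unit_normal \<Omega> x b"
  shows "a = b"
proof (rule ccontr)
  assume "a \<noteq> b"
  have step: "eventually (\<lambda>s. (n \<bullet> h < 0 \<longrightarrow> x + s *\<^sub>R h \<in> \<Omega>) \<and> (0 < n \<bullet> h \<longrightarrow> x + s *\<^sub>R h \<notin> \<Omega>)) (at_right 0)"
    if n: "outward_unit_normal \<Omega> x n" for n h
  proof -
    obtain U g g' where U: "open U" "x \<in> U" and g: "\<And>y. y \<in> U \<Longrightarrow> (g has_derivative (\<lambda>h. g' y \<bullet> h)) (at y)"
      and "g' x \<noteq> 0" and chart: "\<Omega> \<inter> U = {y \<in> U. g y < 0}" and "g x = 0" and n_eq: "n = g' x /\<^sub>R norm (g' x)"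
      using n unfolding outward_unit_normal_def by blast
    have sgn: "(n \<bullet> h < 0 \<longleftrightarrow> g' x \<bullet> h < 0) \<and> (0 < n \<bullet> h \<longleftrightarrow> 0 < g' x \<bullet> h)"
      using \<open>g' x \<noteq> 0\<close> by (simp add: n_eq mult_less_0_iff zero_less_mult_iff divide_inverse[symmetric])
    have "((\<lambda>s. g (x + s *\<^sub>R h)) has_derivative (\<lambda>u. g' x \<bullet> (u *\<^sub>R h))) (at 0)"
      by (rule has_derivative_compose[of "\<lambda>s. x + s *\<^sub>R h" "\<lambda>u. u *\<^sub>R h" 0 UNIV g "\<lambda>v. g' x \<bullet> v"])
         (use g[OF U(2)] in \<open>auto intro!: derivative_eq_intros\<close>)
    then have "((\<lambda>s. g (x + s *\<^sub>R h)) has_real_derivative g' x \<bullet> h) (at 0)"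
      by (simp add: has_field_derivative_def mult_commute_abs)
    then have "((\<lambda>s. g (x + s *\<^sub>R h) / s) \<longlongrightarrow> g' x \<bullet> h) (at 0)"
      using \<open>g x = 0\<close> by (simp add: has_field_derivative_iff)
    then have lim: "((\<lambda>s. g (x + s *\<^sub>R h) / s) \<longlongrightarrow> g' x \<bullet> h) (at_right 0)"
      by (rule filterlim_mono) (auto simp: at_le)
    have "((\<lambda>s. x + s *\<^sub>R h) \<longlongrightarrow> x) (at_right 0)"
      by (auto intro!: tendsto_eq_intros)
    then have inU: "eventually (\<lambda>s. x + s *\<^sub>R h \<in> U) (at_right 0)"
      using U by (rule topological_tendstoD)
    have pos: "eventually (\<lambda>s. 0 < s) (at_right (0::real))" by (simp add: eventually_at_right_less)
    consider "g' x \<bullet> h < 0" | "g' x \<bullet> h = 0" | "0 < g' x \<bullet> h" by linarith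
    then show ?thesis
    proof cases
      case 1
      from order_tendstoD(2)[OF lim 1] inU pos
      show ?thesis
      proof eventually_elim
        case (elim s)
        then have "g (x + s *\<^sub>R h) < 0" by (simp add: divide_less_0_iff)
        then show ?case using elim(2) chart sgn 1 by auto
      qed
    next
      case 2
      then show ?thesis using sgn by simp
    next
      case 3
      from order_tendstoD(1)[OF lim 3] inU pos
      show ?thesis
      proof eventually_elim
        case (elim s)
        then have "\<not> g (x + s *\<^sub>R h) < 0" by (simp add: zero_less_divide_iff)
        then have "x + s *\<^sub>R h \<notin> \<Omega>" using elim(2) chart by blast
        then show ?case using sgn 3 by auto
      qed
    qed
  qed
  have unit: "norm n = 1" if "outward_unit_normal \<Omega> x n" for n
    using that unfolding outward_unit_normal_def by auto
  have "a \<bullet> a = 1" "b \<bullet> b = 1" using unit[OF assms(1)] unit[OF assms(2)] by (simp_all add: dot_square_norm)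
  moreover have "0 < (b - a) \<bullet> (b - a)" using \<open>a \<noteq> b\<close> by simp
  ultimately have "a \<bullet> (b - a) < 0" "0 < b \<bullet> (b - a)"
    by (simp_all add: algebra_simps inner_commute)
  with eventually_conj[OF step[OF assms(1), of "b - a"] step[OF assms(2), of "b - a"]]
  have "eventually (\<lambda>s. False) (at_right (0::real))" by (auto elim: eventually_mono)
  then show False by simp
qed

text \<open>A chart around one boundary point is a chart around all boundary points in its domain, since
  its function vanishes at each of them.\<close>

lemma open_regular_boundary:
  assumes "open \<Omega>" "x \<in> regular_boundary \<Omega>"
  shows "\<exists>V. open V \<and> x \<in> V \<and> V \<inter> frontier \<Omega> \<subseteq> regular_boundary \<Omega>"
proof -
  obtain U g g' where U: "open U" "x \<in> U" and g: "\<forall>y\<in>U. (g has_derivative (\<lambda>h. g' y \<bullet> h)) (at y)"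
    and g': "continuous_on U g'" "\<forall>y\<in>U. g' y \<noteq> 0" and chart: "\<Omega> \<inter> U = {y \<in> U. g y < 0}"
    using assms(2) unfolding regular_boundary_def outward_unit_normal_def by blast
  have "y \<in> regular_boundary \<Omega>" if "y \<in> U" "y \<in> frontier \<Omega>" for y
  proof -
    have "g y = 0"
      using sublevel_chart_frontier[OF assms(1) U(1) _ chart that(2,1), of g'] g by blast
    then have "outward_unit_normal \<Omega> y (g' y /\<^sub>R norm (g' y))"
      using U g g' chart that unfolding outward_unit_normal_def by blast
    then show ?thesis using that by (auto simp: regular_boundary_def)
  qed
  then show ?thesis using U by blast
qed

lemma compact_singular_boundary:
  assumes "open \<Omega>" "bounded \<Omega>"
  shows "compact (frontier \<Omega> - regular_boundary \<Omega>)"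
proof -
  define V where "V = \<Union>{V. open V \<and> V \<inter> frontier \<Omega> \<subseteq> regular_boundary \<Omega>}"
  have "open V" by (auto simp: V_def)
  moreover have "frontier \<Omega> - regular_boundary \<Omega> = frontier \<Omega> - V"
    using open_regular_boundary[OF assms(1)] by (auto simp: V_def)
  moreover have "compact (frontier \<Omega>)" using assms(2) by (rule compact_frontier_bounded)
  ultimately show ?thesis by (simp add: compact_diff)
qed

text \<open>The given normal \<open>\<nu> x\<close> may come from a different chart at every point \<open>x\<close>. Uniqueness of the
  normal makes \<open>F\<close> orthogonal to the gradient of one and the same chart function on a neighbourhood.\<close>

lemma tangential_field_chart:
  assumes dom: "bounded_domain_with_normal \<Omega> \<nu>"
    and tang: "\<And>x. x \<in> regular_boundary \<Omega> \<Longrightarrow> F x \<bullet> \<nu> x = 0"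
    and x0: "x0 \<in> regular_boundary \<Omega>"
  shows "\<exists>U g g'. open U \<and> x0 \<in> U \<and> (\<forall>y\<in>U. (g has_derivative (\<lambda>h. g' y \<bullet> h)) (at y)) \<and>
    continuous_on U g' \<and> (\<forall>y\<in>U. g' y \<noteq> 0) \<and> \<Omega> \<inter> U = {y\<in>U. g y < (0::real)} \<and>
    (\<forall>y\<in>U \<inter> frontier \<Omega>. F y \<bullet> g' y = 0)"
proof -
  have \<Omega>: "open \<Omega>" using dom by (simp add: bounded_domain_with_normal_def)
  obtain U g g' where U: "open U" "x0 \<in> U" and g: "\<forall>y\<in>U. (g has_derivative (\<lambda>h. g' y \<bullet> h)) (at y)"
    and g': "continuous_on U g'" "\<forall>y\<in>U. g' y \<noteq> 0" and chart: "\<Omega> \<inter> U = {y \<in> U. g y < 0}"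
    using x0 unfolding regular_boundary_def outward_unit_normal_def by blast
  have "F y \<bullet> g' y = 0" if "y \<in> U" "y \<in> frontier \<Omega>" for y
  proof -
    have "g y = 0"
      using sublevel_chart_frontier[OF \<Omega> U(1) _ chart that(2,1), of g'] g by blast
    then have n: "outward_unit_normal \<Omega> y (g' y /\<^sub>R norm (g' y))"
      using U g g' chart that unfolding outward_unit_normal_def by blast
    then have y: "y \<in> regular_boundary \<Omega>" using that by (auto simp: regular_boundary_def)
    then have "outward_unit_normal \<Omega> y (\<nu> y)" using dom by (simp add: bounded_domain_with_normal_def)
    then have "\<nu> y = g' y /\<^sub>R norm (g' y)" using n by (rule outward_unit_normal_unique)
    then show ?thesis using tang[OF y] g'(2) that by simp
  qed
  then show ?thesis using U g g' chart by blast
qed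

section \<open>Green's formula near the regular boundary\<close>

text \<open>Translates of \<open>L\<close> by multiples of \<open>s e\<close> are disjoint, and about \<open>1 / s\<close> of them fit into a ball of
  radius larger by one. This replaces Fubini's theorem in the volume estimate of boundary layers.\<close>

lemma measure_thin_layer:
  fixes L :: "'a::euclidean_space set"
  assumes L: "L \<in> lmeasurable" "L \<subseteq> ball x0 r" and e: "norm e = 1" and s: "0 < s"
    and thin: "\<And>x a. x \<in> L \<Longrightarrow> a \<ge> s \<Longrightarrow> x + a *\<^sub>R e \<notin> L"
  shows "measure lebesgue L \<le> s * measure lebesgue (ball x0 (r + 1))"
proof -
  define M where "M = nat \<lfloor>1 / s\<rfloor>"
  have M: "real M * s \<le> 1" "1 < (real M + 1) * s"
  proof -
    have "real M \<le> 1 / s" "1 / s < real M + 1"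
      using s by (auto simp: M_def of_nat_nat)
    then show "real M * s \<le> 1" "1 < (real M + 1) * s" using s by (auto simp: field_simps)
  qed
  define T where "T m = (+) ((real m * s) *\<^sub>R e) ` L" for m
  have disj: "T m \<inter> T m' = {}" if "m < m'" for m m'
  proof (rule ccontr)
    assume "T m \<inter> T m' \<noteq> {}"
    then obtain x y where xy: "x \<in> L" "y \<in> L" "(real m * s) *\<^sub>R e + x = (real m' * s) *\<^sub>R e + y"
      by (auto simp: T_def)
    then have "x = y + ((real m' - real m) * s) *\<^sub>R e"
      by (simp add: algebra_simps)
    moreover have "1 * s \<le> (real m' - real m) * s"
      using that s by (intro mult_right_mono) auto
    ultimately show False using thin[OF xy(2), of "(real m' - real m) * s"] xy(1) by simp
  qed
  have meas: "T m \<in> lmeasurable" "measure lebesgue (T m) = measure lebesgue L" for m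
    using L(1) by (auto simp: T_def measurable_translation measure_translation)
  have "(real M + 1) * measure lebesgue L = (\<Sum>m\<le>M. measure lebesgue (T m))"
    by (simp add: meas)
  also have "\<dots> = measure lebesgue (\<Union>m\<le>M. T m)"
  proof (rule measure_negligible_finite_Union_image[symmetric])
    show "pairwise (\<lambda>m m'. negligible (T m \<inter> T m')) {..M}"
      using disj by (auto simp: pairwise_def) (metis Int_commute linorder_neqE_nat negligible_empty)
  qed (use meas in auto)
  also have "\<dots> \<le> measure lebesgue (ball x0 (r + 1))"
  proof (rule measure_mono_fmeasurable)
    show "(\<Union>m\<le>M. T m) \<subseteq> ball x0 (r + 1)"
    proof
      fix z assume "z \<in> (\<Union>m\<le>M. T m)"
      then obtain m x where mx: "m \<le> M" "x \<in> L" "z = (real m * s) *\<^sub>R e + x" by (auto simp: T_def)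
      have "dist x0 z \<le> dist x0 x + real m * s"
        using mx e s by (metis (no_types, lifting) abs_of_nonneg add.commute add_diff_cancel_right' dist_commute dist_norm dist_triangle less_eq_real_def mult.right_neutral norm_scaleR of_nat_0_le_iff zero_le_mult_iff)
      moreover have "real m * s \<le> real M * s" using mx s by (intro mult_right_mono) auto
      moreover have "dist x0 x < r" using L mx by auto
      ultimately show "z \<in> ball x0 (r + 1)" using M(1) by simp
    qed
  qed (use meas in \<open>auto intro!: fmeasurable.finite_UN\<close>)
  finally have *: "(real M + 1) * measure lebesgue L \<le> measure lebesgue (ball x0 (r + 1))" .
  have "measure lebesgue L \<le> ((real M + 1) * s) * measure lebesgue L"
    using M(2) mult_right_mono[of 1 "(real M + 1) * s" "measure lebesgue L"] by simp
  also have "\<dots> \<le> s * measure lebesgue (ball x0 (r + 1))"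
    using mult_left_mono[OF *, of s] s by (simp add: ac_simps)
  finally show ?thesis .
qed

text \<open>Along \<open>e\<close> the function \<open>g\<close> grows at least at rate \<open>c\<close>, so that a segment in this direction leaves
  the layer after length \<open>\<delta> / c\<close>.\<close>

lemma measure_sublevel_layer:
  fixes g :: "'a::euclidean_space \<Rightarrow> real"
  assumes g: "\<And>y. y \<in> cball x0 r \<Longrightarrow> (g has_derivative (\<lambda>h. g' y \<bullet> h)) (at y)"
    and e: "norm e = 1" and c: "0 < c" "\<And>y. y \<in> cball x0 r \<Longrightarrow> c \<le> g' y \<bullet> e" and \<delta>: "0 < \<delta>"
  shows "{y \<in> cball x0 r. - \<delta> < g y \<and> g y < 0} \<in> sets borel"
    and "measure lebesgue {y \<in> cball x0 r. - \<delta> < g y \<and> g y < 0}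
          \<le> \<delta> / c * measure lebesgue (ball x0 (r + 2))" (is "measure lebesgue ?L \<le> _")
proof -
  have "continuous_on (cball x0 r) g"
    using g by (meson continuous_at_imp_continuous_on has_derivative_continuous)
  then have "openin (top_of_set (cball x0 r)) (cball x0 r \<inter> g -` {-\<delta><..<0})"
    by (rule continuous_openin_preimage_gen) simp
  moreover have L_eq: "cball x0 r \<inter> g -` {-\<delta><..<0} = ?L" by auto
  ultimately obtain T where T: "open T" "?L = cball x0 r \<inter> T" by (auto simp: openin_open)
  then show L: "?L \<in> sets borel" by (simp only: T(2)) auto
  have "?L \<in> lmeasurable"
    using L by (intro bounded_set_imp_lmeasurable) (auto intro: bounded_subset[OF bounded_cball[of x0 r]])
  moreover have "?L \<subseteq> ball x0 (r + 1)" by auto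
  moreover have "x + a *\<^sub>R e \<notin> ?L" if "x \<in> ?L" "\<delta> / c \<le> a" for x a
  proof
    assume y: "x + a *\<^sub>R e \<in> ?L"
    have "0 < a" using that(2) \<delta> c(1) by (meson divide_pos_pos less_le_trans)
    have seg: "x + s *\<^sub>R e \<in> cball x0 r" if "0 \<le> s" "s \<le> a" for s
    proof -
      have "x + s *\<^sub>R e = (1 - s / a) *\<^sub>R x + (s / a) *\<^sub>R (x + a *\<^sub>R e)"
        using \<open>0 < a\<close> by (simp add: algebra_simps)
      then show ?thesis
        using that \<open>0 < a\<close> \<open>x \<in> ?L\<close> y convexD_alt[OF convex_cball, of x x0 r "x + a *\<^sub>R e" "s / a"]
        by simp
    qed
    have "((\<lambda>s. g (x + s *\<^sub>R e)) has_real_derivative g' (x + s *\<^sub>R e) \<bullet> e) (at s)" if "0 \<le> s" "s \<le> a" for s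
    proof -
      have "((\<lambda>s. g (x + s *\<^sub>R e)) has_derivative (\<lambda>u. g' (x + s *\<^sub>R e) \<bullet> (u *\<^sub>R e))) (at s)"
        by (rule has_derivative_compose[of "\<lambda>s. x + s *\<^sub>R e" "\<lambda>u. u *\<^sub>R e" s UNIV g "\<lambda>v. g' (x + s *\<^sub>R e) \<bullet> v"])
           (use g[OF seg[OF that]] in \<open>auto intro!: derivative_eq_intros\<close>)
      then show ?thesis by (simp add: has_field_derivative_def mult_commute_abs)
    qed
    from MVT2[OF \<open>0 < a\<close> this] obtain z where z: "0 < z" "z < a"
      "g (x + a *\<^sub>R e) - g (x + 0 *\<^sub>R e) = (a - 0) * (g' (x + z *\<^sub>R e) \<bullet> e)" by blast
    have "\<delta> \<le> a * c" using that(2) c(1) by (simp add: field_simps)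
    also have "\<dots> \<le> a * (g' (x + z *\<^sub>R e) \<bullet> e)"
      using c(2)[OF seg[of z]] z(1,2) \<open>0 < a\<close> by (intro mult_left_mono) auto
    finally show False using z(3) \<open>x \<in> ?L\<close> y by simp
  qed
  ultimately have "measure lebesgue ?L \<le> \<delta> / c * measure lebesgue (ball x0 (r + 1 + 1))"
    using \<delta> c(1) e by (intro measure_thin_layer[where e = e]) auto
  moreover have "r + 1 + 1 = r + 2" by simp
  ultimately show "measure lebesgue ?L \<le> \<delta> / c * measure lebesgue (ball x0 (r + 2))" by metis
qed

text \<open>Multiplied by \<open>c1_step (- g / \<delta>)\<close>, the test function gets compact support in the domain. The error is
  concentrated in the layer \<open>-2\<delta> < g < 0\<close>, whose volume is \<open>O(\<delta>)\<close>. There the gradient of the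
  cutoff contributes \<open>F \<bullet> \<nabla>g\<close> times a factor of order \<open>1/\<delta>\<close>, and \<open>F \<bullet> \<nabla>g\<close> is uniformly small because it is
  continuous and vanishes on the boundary. Hence the Green form is arbitrarily small.\<close>

lemma green_form_boundary_chart:
  fixes F :: "real ^ 'd \<Rightarrow> real ^ 'd"
  assumes \<Omega>: "open \<Omega>" "bounded \<Omega>" and F: "Ck_closure 1 \<Omega> F"
    and U: "open U" "x0 \<in> U" and g: "\<And>y. y \<in> U \<Longrightarrow> (g has_derivative (\<lambda>h. g' y \<bullet> h)) (at y)"
    and g': "continuous_on U g'" "g' x0 \<noteq> 0" and chart: "\<Omega> \<inter> U = {y \<in> U. g y < (0::real)}"
    and tang: "\<And>y. y \<in> U \<Longrightarrow> y \<in> frontier \<Omega> \<Longrightarrow> F y \<bullet> g' y = 0"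
  shows "\<exists>r>0. \<forall>\<phi> D. test_function \<phi> D \<longrightarrow> (\<forall>x. x \<notin> ball x0 r \<longrightarrow> \<phi> x = 0) \<longrightarrow> green_form \<Omega> F \<phi> D = 0"
proof -
  define e where "e = g' x0 /\<^sub>R norm (g' x0)"
  define c where "c = norm (g' x0) / 2"
  have e: "norm e = 1" and c: "0 < c" using g'(2) by (auto simp: e_def c_def)
  have contg: "continuous_on U g"
    using g by (meson continuous_at_imp_continuous_on has_derivative_continuous)
  have "g' x0 \<bullet> e = norm (g' x0)"
    using g'(2) by (simp add: e_def dot_square_norm power2_eq_square field_simps)
  then have c_less: "c < g' x0 \<bullet> e"
    using g'(2) by (simp add: c_def)
  have "((\<lambda>y. g' y \<bullet> e) \<longlongrightarrow> g' x0 \<bullet> e) (nhds x0)"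
    using g'(1) U by (intro tendsto_intros) (simp add: continuous_on_eq_continuous_at tendsto_nhds_iff isCont_def)
  from order_tendstoD(1)[OF this c_less]
  obtain d1 where d1: "0 < d1" "\<And>y. dist y x0 < d1 \<Longrightarrow> c < g' y \<bullet> e"
    unfolding eventually_nhds_metric by blast
  obtain d2 where d2: "0 < d2" "cball x0 d2 \<subseteq> U" using U open_contains_cball by blast
  define r where "r = min (d1 / 2) d2"
  define B where "B = cball x0 r"
  have r: "0 < r" and BU: "B \<subseteq> U" and Bc: "\<And>y. y \<in> B \<Longrightarrow> c \<le> g' y \<bullet> e" and B: "compact B" "closed B"
    using d1 d2 by (auto simp: r_def B_def dist_commute subset_iff intro!: less_imp_le[OF d1(2)])
  define V where "V = measure lebesgue (ball x0 (r + 2))"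
  have "green_form \<Omega> F \<phi> D = 0" if \<phi>: "test_function \<phi> D" and supp: "\<And>x. x \<notin> ball x0 r \<Longrightarrow> \<phi> x = 0" for \<phi> D
  proof -
    have B': "open (- B)" "U \<union> - B = UNIV" using B BU by (auto simp: open_Compl)
    have \<phi>0: "\<phi> x = 0" "D x = 0" if "x \<notin> B" for x
    proof -
      show "\<phi> x = 0" using that supp[of x] by (auto simp: B_def)
      show "D x = 0"
        by (rule test_function_gradient_eq_0[OF \<phi> B'(1), of x 0]) (use that supp in \<open>auto simp: B_def\<close>)
    qed
    obtain dv where dv: "continuous_on (closure \<Omega>) dv" "\<forall>x\<in>\<Omega>. dv x = divergence F x"
      using divergence_extends_continuously[OF \<Omega>(1) F] by (elim exE conjE)
    have contF: "continuous_on (closure \<Omega>) F" using F by simp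
    have "continuous_on (closure \<Omega>) (\<lambda>x. \<phi> x * dv x + F x \<bullet> D x)"
      by (intro continuous_intros dv contF test_function_continuous[OF \<phi>] test_function_gradient_continuous[OF \<phi>])
    then obtain A where A: "0 \<le> A" "\<forall>x\<in>closure \<Omega>. norm (\<phi> x * dv x + F x \<bullet> D x) \<le> A"
      using continuous_on_closure_bounded[OF \<Omega>(2)] by blast
    obtain M where M: "0 \<le> M" "\<forall>x\<in>closure \<Omega>. norm (\<phi> x) \<le> M"
      using continuous_on_closure_bounded[OF \<Omega>(2) test_function_continuous[OF \<phi>]] by blast
    \<comment> \<open>The points where \<open>F \<bullet> \<nabla>g\<close> is not small form a compact set that misses the boundary of the
        domain, so on it \<open>g\<close> stays away from zero.\<close>
    have small: "\<exists>\<delta>0>0. \<forall>x\<in>B \<inter> \<Omega>. - (2 * \<delta>0) < g x \<longrightarrow> \<bar>F x \<bullet> g' x\<bar> < \<epsilon>" if "0 < \<epsilon>" for \<epsilon>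
    proof -
      define K where "K = {x \<in> B \<inter> closure \<Omega>. \<epsilon> \<le> \<bar>F x \<bullet> g' x\<bar>}"
      have "continuous_on (B \<inter> closure \<Omega>) (\<lambda>x. \<bar>F x \<bullet> g' x\<bar>)"
        by (intro continuous_intros continuous_on_subset[OF contF] continuous_on_subset[OF g'(1)]) (use BU in auto)
      then have "closedin (top_of_set (B \<inter> closure \<Omega>)) (B \<inter> closure \<Omega> \<inter> (\<lambda>x. \<bar>F x \<bullet> g' x\<bar>) -` {\<epsilon>..})"
        by (rule continuous_closedin_preimage) simp
      moreover have "B \<inter> closure \<Omega> \<inter> (\<lambda>x. \<bar>F x \<bullet> g' x\<bar>) -` {\<epsilon>..} = K" by (auto simp: K_def)
      moreover have "compact (B \<inter> closure \<Omega>)" using B by (simp add: compact_Int_closed)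
      ultimately have K: "compact K" using closedin_compact by metis
      have neg: "g x < 0" if "x \<in> K" for x
      proof -
        have "x \<notin> frontier \<Omega>" using that tang BU \<open>0 < \<epsilon>\<close> by (auto simp: K_def)
        then have "x \<in> \<Omega>" using that \<Omega>(1) by (auto simp: K_def frontier_def interior_open)
        then show ?thesis using chart that BU by (auto simp: K_def)
      qed
      show ?thesis
      proof (cases "K = {}")
        case True
        then show ?thesis using closure_subset[of \<Omega>] by (intro exI[of _ 1]) (force simp: K_def)
      next
        case False
        have "continuous_on K g" using contg by (rule continuous_on_subset) (use BU in \<open>auto simp: K_def\<close>)
        then obtain x where x: "x \<in> K" "\<forall>y\<in>K. g y \<le> g x"
          using continuous_attains_sup[OF K False] by blast
        have "\<bar>F y \<bullet> g' y\<bar> < \<epsilon>" if "y \<in> B \<inter> \<Omega>" "- (2 * (- g x / 2)) < g y" for y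
        proof (rule ccontr)
          assume "\<not> \<bar>F y \<bullet> g' y\<bar> < \<epsilon>"
          then have "y \<in> K" using that(1) closure_subset[of \<Omega>] by (auto simp: K_def)
          then show False using x(2) that(2) by fastforce
        qed
        then show ?thesis using neg[OF x(1)] by (intro exI[of _ "- g x / 2"]) auto
      qed
    qed
    have bound: "\<bar>green_form \<Omega> F \<phi> D\<bar> \<le> (2 * A * V / c + 8 * M * V / c) * \<epsilon>" if eps: "0 < \<epsilon>" for \<epsilon>
    proof -
      obtain \<delta>0 where \<delta>0: "0 < \<delta>0" "\<forall>x\<in>B \<inter> \<Omega>. - (2 * \<delta>0) < g x \<longrightarrow> \<bar>F x \<bullet> g' x\<bar> < \<epsilon>"
        using small[OF eps] by blast
      define \<delta> where "\<delta> = min \<delta>0 \<epsilon>"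
      have \<delta>: "0 < \<delta>" "\<delta> \<le> \<epsilon>" "\<delta> \<le> \<delta>0" using \<delta>0 eps by (auto simp: \<delta>_def)
      \<comment> \<open>The chart function is meaningful only on \<open>U\<close>. As \<open>\<phi>\<close> vanishes outside \<open>B\<close>, which is contained in
          \<open>U\<close>, extension by zero is again a test function.\<close>
      define \<psi> where "\<psi> x = (if x \<in> U then \<phi> x * c1_step (- g x / \<delta>) else 0)" for x
      define E where "E x = (if x \<in> U then c1_step (- g x / \<delta>) *\<^sub>R D x
          - (\<phi> x * c1_step' (- g x / \<delta>) / \<delta>) *\<^sub>R g' x else 0)" for x
      have \<psi>0: "\<psi> x = 0" "E x = 0" if "x \<notin> B" for x using \<phi>0[OF that] by (auto simp: \<psi>_def E_def)
      have \<psi>: "test_function \<psi> E"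
      proof -
        have "(\<psi> has_derivative (\<lambda>h. E x \<bullet> h)) (at x)" for x
        proof (cases "x \<in> U")
          case True
          have "((\<lambda>y. - g y / \<delta>) has_derivative (\<lambda>h. - (g' x \<bullet> h) / \<delta>)) (at x)"
            using g[OF True] \<delta>(1) by (auto intro!: derivative_eq_intros)
          from has_derivative_compose[OF this has_real_derivative_c1_step[unfolded has_field_derivative_def]]
          have 1: "((\<lambda>y. c1_step (- g y / \<delta>)) has_derivative
              (\<lambda>h. c1_step' (- g x / \<delta>) * (- (g' x \<bullet> h) / \<delta>))) (at x)" .
          have 2: "(\<phi> has_derivative (\<lambda>h. D x \<bullet> h)) (at x)" using \<phi> by (simp add: test_function_def)
          have 3: "\<phi> x * (c1_step' (- g x / \<delta>) * (- (g' x \<bullet> h) / \<delta>)) + (D x \<bullet> h) * c1_step (- g x / \<delta>) = E x \<bullet> h" for h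
            using True by (simp add: E_def inner_diff_left algebra_simps)
          have "((\<lambda>y. \<phi> y * c1_step (- g y / \<delta>)) has_derivative (\<lambda>h. E x \<bullet> h)) (at x)"
            using has_derivative_mult[OF 2 1] unfolding 3 .
          then show ?thesis
            by (rule has_derivative_transform_within_open[OF _ U(1) True]) (simp add: \<psi>_def)
        next
          case False
          have "((\<lambda>y. 0) has_derivative (\<lambda>h. E x \<bullet> h)) (at x)" using False by (simp add: E_def)
          then show ?thesis
            by (rule has_derivative_transform_within_open[OF _ B'(1)]) (use False BU \<psi>0 in auto)
        qed
        moreover have "continuous_on UNIV E"
        proof -
          have "continuous_on U (\<lambda>x. c1_step (- g x / \<delta>))" "continuous_on U (\<lambda>x. c1_step' (- g x / \<delta>))"
          proof -
            have "continuous_on U (\<lambda>x. - g x / \<delta>)" using \<delta>(1) by (intro continuous_intros contg) simp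
            then show "continuous_on U (\<lambda>x. c1_step (- g x / \<delta>))" "continuous_on U (\<lambda>x. c1_step' (- g x / \<delta>))"
              using continuous_on_c1_step'[of UNIV] continuous_at_imp_continuous_on[of UNIV c1_step]
                DERIV_isCont[OF has_real_derivative_c1_step]
              by (auto intro: continuous_on_compose2)
          qed
          then have "continuous_on U (\<lambda>x. c1_step (- g x / \<delta>) *\<^sub>R D x - (\<phi> x * c1_step' (- g x / \<delta>) / \<delta>) *\<^sub>R g' x)"
            using \<delta>(1) by (intro continuous_intros g' test_function_continuous[OF \<phi>] test_function_gradient_continuous[OF \<phi>]) auto
          then have "continuous_on U E" by (rule continuous_on_eq) (simp add: E_def)
          moreover have "continuous_on (- B) E"
            by (rule continuous_on_eq[OF continuous_on_const[of _ 0]]) (simp add: \<psi>0)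
          ultimately show ?thesis using continuous_on_open_Un[OF U(1) B'(1)] by (simp add: B'(2))
        qed
        ultimately show ?thesis by (simp add: test_function_def)
      qed
      have "green_form \<Omega> F \<psi> E = 0"
      proof (rule green_form_compact_support[OF \<Omega> F \<psi>])
        have "continuous_on B g" using contg BU by (rule continuous_on_subset)
        then have "closedin (top_of_set B) (B \<inter> g -` {..- \<delta>})"
          by (rule continuous_closedin_preimage) simp
        then show "compact (B \<inter> g -` {..- \<delta>})" using B(1) closedin_compact by blast
        show "B \<inter> g -` {..- \<delta>} \<subseteq> \<Omega>"
        proof
          fix y assume "y \<in> B \<inter> g -` {..- \<delta>}"
          then have "y \<in> U" "g y < 0" using BU \<delta>(1) by auto
          then show "y \<in> \<Omega>" using chart by blast
        qed
        show "\<psi> x = 0" if "x \<notin> B \<inter> g -` {..- \<delta>}" for x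
        proof (cases "x \<in> B")
          case True
          then have "- g x \<le> \<delta>" using that by auto
          then have "- g x / \<delta> \<le> 1" using \<delta>(1) divide_right_mono[of "- g x" \<delta> \<delta>] by simp
          then show ?thesis by (simp add: \<psi>_def c1_step_eq_0)
        qed (simp add: \<psi>0)
      qed
      then have eq: "green_form \<Omega> F \<phi> D = green_form \<Omega> F (\<lambda>x. \<phi> x - \<psi> x) (\<lambda>x. D x - E x)"
        using green_form_diff[OF \<Omega> F \<phi> \<psi>] by simp
      define L where "L = {y \<in> cball x0 r. - (2 * \<delta>) < g y \<and> g y < 0}"
      have L: "L \<in> sets borel" "measure lebesgue L \<le> 2 * \<delta> / c * V"
      proof -
        have gB: "(g has_derivative (\<lambda>h. g' y \<bullet> h)) (at y)" if "y \<in> cball x0 r" for y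
          using g BU that by (auto simp: B_def)
        show "L \<in> sets borel" "measure lebesgue L \<le> 2 * \<delta> / c * V"
          using measure_sublevel_layer[OF gB e c, where \<delta> = "2 * \<delta>"] Bc \<delta>(1) by (auto simp: L_def B_def V_def)
      qed
      have "\<bar>green_form \<Omega> F \<phi> D\<bar> \<le> (A + 4 * M * \<epsilon> / \<delta>) * measure lebesgue L"
        unfolding eq unfolding green_form_def
      proof (rule set_integral_le_measure[OF green_form_integrable[OF \<Omega> F test_function_diff[OF \<phi> \<psi>]] L(1)])
        show "bounded L" by (rule bounded_subset[OF bounded_cball[of x0 r]]) (auto simp: L_def)
        show "0 \<le> A + 4 * M * \<epsilon> / \<delta>" using A M \<delta> eps by simp
        \<comment> \<open>The first part is bounded on the layer. The second part carries the derivative of the cutoff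
            and is the place where tangentiality enters.\<close>
        have decomp: "(\<phi> x - \<psi> x) * divergence F x + F x \<bullet> (D x - E x)
          = (1 - c1_step (- g x / \<delta>)) * (\<phi> x * dv x + F x \<bullet> D x)
            + \<phi> x * c1_step' (- g x / \<delta>) / \<delta> * (F x \<bullet> g' x)" if "x \<in> \<Omega>" "x \<in> U" for x
          using that dv(2) by (simp add: \<psi>_def E_def inner_diff_right algebra_simps)
        show "\<bar>(\<phi> x - \<psi> x) * divergence F x + F x \<bullet> (D x - E x)\<bar> \<le> A + 4 * M * \<epsilon> / \<delta>"
          if "x \<in> \<Omega>" "x \<in> L" for x
        proof -
          have x: "x \<in> B" "x \<in> U" "x \<in> closure \<Omega>" "- (2 * \<delta>) < g x"
            using that BU closure_subset[of \<Omega>] by (auto simp: L_def B_def)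
          have b1: "\<bar>(1 - c1_step (- g x / \<delta>)) * (\<phi> x * dv x + F x \<bullet> D x)\<bar> \<le> 1 * A"
            unfolding abs_mult
            by (rule mult_mono) (use c1_step_range[of "- g x / \<delta>"] A x in auto)
          have b2: "\<bar>\<phi> x * c1_step' (- g x / \<delta>) / \<delta> * (F x \<bullet> g' x)\<bar> \<le> M * 4 / \<delta> * \<epsilon>"
          proof -
            have "\<bar>F x \<bullet> g' x\<bar> \<le> \<epsilon>" using \<delta>0(2) x \<delta>(3) that(1) by (intro less_imp_le) auto
            moreover have "\<bar>\<phi> x * c1_step' (- g x / \<delta>) / \<delta>\<bar> \<le> M * 4 / \<delta>"
              using M x(3) c1_step'_bound[of "- g x / \<delta>"] \<delta>(1)
              by (auto simp: abs_mult intro!: divide_right_mono mult_mono)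
            ultimately show ?thesis unfolding abs_mult[of _ "F x \<bullet> g' x"] using M \<delta>(1) by (intro mult_mono) auto
          qed
          have "1 * A + M * 4 / \<delta> * \<epsilon> = A + 4 * M * \<epsilon> / \<delta>" by simp
          with order_trans[OF abs_triangle_ineq add_mono[OF b1 b2]]
          show ?thesis unfolding decomp[OF that(1) x(2)] by (simp only:)
        qed
        show "(\<phi> x - \<psi> x) * divergence F x + F x \<bullet> (D x - E x) = 0" if "x \<in> \<Omega>" "x \<notin> L" for x
        proof (cases "x \<in> B")
          case True
          then have "x \<in> U" using BU by blast
          then have "g x < 0" using chart that(1) by blast
          then have "g x \<le> - (2 * \<delta>)" using that True by (auto simp: L_def B_def)
          then have "2 \<le> - g x / \<delta>" using \<delta>(1) divide_right_mono[of "2 * \<delta>" "- g x" \<delta>] by simp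
          then show ?thesis
            using decomp[OF that(1) \<open>x \<in> U\<close>] by (simp add: c1_step_eq_1 c1_step'_eq_0)
        qed (simp add: \<phi>0 \<psi>0)
      qed
      also have "\<dots> \<le> (A + 4 * M * \<epsilon> / \<delta>) * (2 * \<delta> / c * V)"
        using L(2) A M \<delta> eps by (intro mult_left_mono) auto
      also have "\<dots> = 2 * A * V / c * \<delta> + 8 * M * V / c * \<epsilon>"
        using \<delta>(1) c by (simp add: field_simps)
      also have "\<dots> \<le> 2 * A * V / c * \<epsilon> + 8 * M * V / c * \<epsilon>"
        using \<delta>(2) A c by (intro add_right_mono mult_left_mono) (auto simp: V_def)
      finally show ?thesis by (simp add: algebra_simps)
    qed
    define C where "C = 2 * A * V / c + 8 * M * V / c"
    have "0 \<le> C" using A M c by (auto simp: C_def V_def)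
    have "\<bar>green_form \<Omega> F \<phi> D\<bar> \<le> 0 + \<epsilon>" if "0 < \<epsilon>" for \<epsilon>
    proof -
      have "\<bar>green_form \<Omega> F \<phi> D\<bar> \<le> C * (\<epsilon> / (C + 1))"
        using bound[of "\<epsilon> / (C + 1)"] that \<open>0 \<le> C\<close> by (simp add: C_def)
      also have "\<dots> \<le> \<epsilon>" using that \<open>0 \<le> C\<close> by (simp add: field_simps)
      finally show ?thesis by simp
    qed
    then have "\<bar>green_form \<Omega> F \<phi> D\<bar> \<le> 0" by (rule field_le_epsilon)
    then show ?thesis by simp
  qed
  then show ?thesis using r by blast
qed

section \<open>Gluing local formulas and removing the singular boundary\<close>

text \<open>The splitting \<open>\<phi> = \<phi> b + \<phi> (1 - b)\<close> with a bump \<open>b\<close> removes one ball from the cover at a time and so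
  takes the place of a partition of unity.\<close>

lemma green_form_finite_cover:
  fixes F :: "real ^ 'd \<Rightarrow> real ^ 'd"
  assumes \<Omega>: "open \<Omega>" "bounded \<Omega>" and F: "Ck_closure 1 \<Omega> F"
    and "finite A" and r: "\<And>a. a \<in> A \<Longrightarrow> 0 < r a"
    and loc: "\<And>a \<phi> D. a \<in> A \<Longrightarrow> test_function \<phi> D \<Longrightarrow> (\<And>x. x \<notin> ball a (2 * r a) \<Longrightarrow> \<phi> x = 0) \<Longrightarrow>
      green_form \<Omega> F \<phi> D = 0"
    and \<phi>: "test_function \<phi> D" "\<And>x. x \<in> \<Omega> \<Longrightarrow> \<phi> x \<noteq> 0 \<Longrightarrow> x \<in> (\<Union>a\<in>A. ball a (r a))"
  shows "green_form \<Omega> F \<phi> D = 0"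
  using \<open>finite A\<close> r loc \<phi>
proof (induction A arbitrary: \<phi> D rule: finite_induct)
  case empty
  have "green_form \<Omega> F \<phi> D = green_form \<Omega> F (\<lambda>x. 0) (\<lambda>x. 0)"
    by (rule green_form_cong[OF \<Omega> F _ empty.prems(3) test_function_const]) (use empty.prems(4) in auto)
  then show ?case by (simp add: green_form_def)
next
  case (insert a A)
  obtain b Db where b: "test_function b Db" "\<forall>x\<in>ball a (r a). b x = 1"
    "\<forall>x. x \<notin> ball a (2 * r a) \<longrightarrow> b x = 0 \<and> Db x = 0"
    using bump_test_function[of "r a" a] insert.prems(1) by auto
  note T = test_function_mult[OF insert.prems(3) b(1)]
  have "green_form \<Omega> F (\<lambda>x. \<phi> x * b x) (\<lambda>x. \<phi> x *\<^sub>R Db x + b x *\<^sub>R D x) = 0"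
    by (rule insert.prems(2)[OF _ T]) (use b(3) in auto)
  moreover have "green_form \<Omega> F (\<lambda>x. \<phi> x - \<phi> x * b x) (\<lambda>x. D x - (\<phi> x *\<^sub>R Db x + b x *\<^sub>R D x)) = 0"
  proof (rule insert.IH[OF _ _ test_function_diff[OF insert.prems(3) T]])
    show "0 < r a'" if "a' \<in> A" for a' using insert.prems(1) that by simp
    show "green_form \<Omega> F \<psi> E = 0" if "a' \<in> A" "test_function \<psi> E" "\<And>x. x \<notin> ball a' (2 * r a') \<Longrightarrow> \<psi> x = 0"
      for a' \<psi> E by (rule insert.prems(2)[OF _ that(2,3)]) (use that(1) in auto)
    show "x \<in> (\<Union>a\<in>A. ball a (r a))" if "x \<in> \<Omega>" "\<phi> x - \<phi> x * b x \<noteq> 0" for x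
    proof -
      have "\<phi> x \<noteq> 0" "b x \<noteq> 1" using that(2) by auto
      then have "x \<in> (\<Union>a\<in>insert a A. ball a (r a))" "x \<notin> ball a (r a)"
        using insert.prems(4)[OF that(1)] b(2) by blast+
      then show ?thesis by blast
    qed
  qed
  ultimately show ?case using green_form_diff[OF \<Omega> F insert.prems(3) T] by simp
qed

text \<open>Such a net still covers at a comparable scale, while the balls of radius \<open>\<epsilon> / 2\<close> around its points are
  disjoint. This allows sums over the net to be compared with a volume.\<close>

lemma finite_separated_net:
  fixes A :: "'a::metric_space set"
  assumes "finite A" "0 < \<epsilon>"
  shows "\<exists>Z\<subseteq>A. pairwise (\<lambda>x y. \<epsilon> \<le> dist x y) Z \<and> (\<forall>a\<in>A. \<exists>z\<in>Z. dist z a < \<epsilon>)"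
  using assms(1)
proof (induction A rule: finite_induct)
  case empty
  then show ?case by auto
next
  case (insert a A)
  then obtain Z where Z: "Z \<subseteq> A" "pairwise (\<lambda>x y. \<epsilon> \<le> dist x y) Z" "\<forall>a\<in>A. \<exists>z\<in>Z. dist z a < \<epsilon>" by blast
  show ?case
  proof (cases "\<exists>z\<in>Z. dist z a < \<epsilon>")
    case True
    then show ?thesis using Z by (intro exI[of _ Z]) auto
  next
    case False
    then have "pairwise (\<lambda>x y. \<epsilon> \<le> dist x y) (insert a Z)"
      using Z(2) by (auto simp: pairwise_insert dist_commute not_less)
    moreover have "\<forall>c\<in>insert a A. \<exists>z\<in>insert a Z. dist z c < \<epsilon>" using Z(3) assms(2) by auto
    moreover have "insert a Z \<subseteq> insert a A" using Z(1) by blast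
    ultimately show ?thesis by (intro exI[of _ "insert a Z"] conjI)
  qed
qed

text \<open>The cutoff is the product of the factors one minus bump. By the product rule its defect and its
  gradient are dominated by sums of indicator functions, so only the sum of the volumes of the balls
  matters, however much they overlap.\<close>

lemma cutoff_finite_balls:
  fixes Z :: "'a::euclidean_space set"
  assumes "finite Z" "0 < r"
  shows "\<exists>\<psi> D. test_function \<psi> D \<and> (\<forall>x. 0 \<le> \<psi> x \<and> \<psi> x \<le> 1) \<and> (\<forall>z\<in>Z. \<forall>x\<in>ball z r. \<psi> x = 0) \<and>
    (\<forall>x. 1 - \<psi> x \<le> (\<Sum>z\<in>Z. indicator (ball z (2 * r)) x)) \<and>
    (\<forall>x. norm (D x) \<le> 16 / r * (\<Sum>z\<in>Z. indicator (ball z (2 * r)) x))"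
  using assms(1)
proof (induction Z rule: finite_induct)
  case empty
  then show ?case
    by (intro exI[of _ "\<lambda>x. 1"] exI[of _ "\<lambda>x. 0"]) (simp add: test_function_const)
next
  case (insert a Z)
  then obtain \<psi> D where \<psi>: "test_function \<psi> D" "\<forall>x. 0 \<le> \<psi> x \<and> \<psi> x \<le> 1" "\<forall>z\<in>Z. \<forall>x\<in>ball z r. \<psi> x = 0"
    "\<forall>x. 1 - \<psi> x \<le> (\<Sum>z\<in>Z. indicator (ball z (2 * r)) x)"
    "\<forall>x. norm (D x) \<le> 16 / r * (\<Sum>z\<in>Z. indicator (ball z (2 * r)) x)" by blast
  obtain b Db where b: "test_function b Db" "\<forall>x. 0 \<le> b x \<and> b x \<le> 1 \<and> norm (Db x) \<le> 16 / r"
    "\<forall>x\<in>ball a r. b x = 1" "\<forall>x. x \<notin> ball a (2 * r) \<longrightarrow> b x = 0 \<and> Db x = 0"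
    using bump_test_function[OF assms(2), of a] by blast
  define \<psi>' where "\<psi>' x = \<psi> x * (1 - b x)" for x
  define D' where "D' x = \<psi> x *\<^sub>R (0 - Db x) + (1 - b x) *\<^sub>R D x" for x
  have "test_function \<psi>' D'"
    using test_function_mult[OF \<psi>(1) test_function_diff[OF test_function_const[of 1] b(1)]]
    unfolding \<psi>'_def[abs_def] D'_def[abs_def] .
  moreover have "0 \<le> \<psi>' x \<and> \<psi>' x \<le> 1" for x
    using \<psi>(2)[rule_format, of x] b(2)[rule_format, of x] mult_mono[of "\<psi> x" 1 "1 - b x" 1]
    by (auto simp: \<psi>'_def)
  moreover have "\<psi>' x = 0" if "z \<in> insert a Z" "x \<in> ball z r" for x z
    using that \<psi>(3) b(3) by (auto simp: \<psi>'_def)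
  moreover have "1 - \<psi>' x \<le> (\<Sum>z\<in>insert a Z. indicator (ball z (2 * r)) x)" for x
  proof -
    have "b x \<le> indicator (ball a (2 * r)) x" using b(2,4) by (auto simp: indicator_def)
    moreover have "\<psi> x * b x \<le> b x" using \<psi>(2) b(2) by (simp add: mult_left_le_one_le)
    moreover have "1 - \<psi>' x = 1 - \<psi> x + \<psi> x * b x" by (simp add: \<psi>'_def algebra_simps)
    moreover have "1 - \<psi> x \<le> (\<Sum>z\<in>Z. indicator (ball z (2 * r)) x)" using \<psi>(4) by blast
    ultimately show ?thesis using insert.hyps by simp
  qed
  moreover have "norm (D' x) \<le> 16 / r * (\<Sum>z\<in>insert a Z. indicator (ball z (2 * r)) x)" for x
  proof -
    have "norm (D' x) \<le> \<psi> x * norm (Db x) + (1 - b x) * norm (D x)"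
      using norm_triangle_ineq[of "\<psi> x *\<^sub>R (0 - Db x)" "(1 - b x) *\<^sub>R D x"] \<psi>(2) b(2) by (simp add: D'_def)
    also have "\<dots> \<le> norm (Db x) + norm (D x)"
      using \<psi>(2) b(2) by (intro add_mono) (auto simp: mult_left_le_one_le)
    also have "norm (Db x) \<le> 16 / r * indicator (ball a (2 * r)) x"
      using b(2,4) by (auto simp: indicator_def)
    also have "norm (D x) \<le> 16 / r * (\<Sum>z\<in>Z. indicator (ball z (2 * r)) x)" using \<psi>(5) by blast
    finally show ?thesis using insert.hyps by (simp add: distrib_left)
  qed
  ultimately show ?case by blast
qed

text \<open>Each ball has \<open>8\<close> to the power of the dimension times the volume of the concentric ball of radius
  \<open>\<epsilon> / 2\<close>, and these smaller balls are disjoint.\<close>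

lemma sum_measure_separated_balls:
  fixes Z :: "'a::euclidean_space set"
  assumes Z: "finite Z" "Z \<subseteq> S" "pairwise (\<lambda>x y. \<epsilon> \<le> dist x y) Z" and \<epsilon>: "0 < \<epsilon>" and S: "bounded S"
  shows "(\<Sum>z\<in>Z. measure lebesgue (ball z (4 * \<epsilon>))) \<le> 8 ^ DIM('a) * measure lebesgue (\<Union>x\<in>S. ball x \<epsilon>)"
proof -
  have "measure lebesgue (ball z (4 * \<epsilon>)) = 8 ^ DIM('a) * measure lebesgue (ball z (\<epsilon> / 2))" for z :: 'a
  proof -
    have "(4 * \<epsilon>) ^ DIM('a) = (8 * (\<epsilon> / 2)) ^ DIM('a)" by simp
    also have "\<dots> = 8 ^ DIM('a) * (\<epsilon> / 2) ^ DIM('a)" by (rule power_mult_distrib)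
    finally show ?thesis using \<epsilon> content_ball[of "4 * \<epsilon>" z] content_ball[of "\<epsilon> / 2" z] by simp
  qed
  then have "(\<Sum>z\<in>Z. measure lebesgue (ball z (4 * \<epsilon>)))
      = 8 ^ DIM('a) * (\<Sum>z\<in>Z. measure lebesgue (ball z (\<epsilon> / 2)))"
    by (simp add: sum_distrib_left)
  also have "(\<Sum>z\<in>Z. measure lebesgue (ball z (\<epsilon> / 2))) = measure lebesgue (\<Union>z\<in>Z. ball z (\<epsilon> / 2))"
  proof (rule measure_negligible_finite_Union_image[symmetric, OF Z(1)])
    show "pairwise (\<lambda>x y. negligible (ball x (\<epsilon> / 2) \<inter> ball y (\<epsilon> / 2))) Z"
      unfolding pairwise_def
    proof (intro ballI impI)
      fix x y assume "x \<in> Z" "y \<in> Z" "x \<noteq> y"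
      then have "\<epsilon> \<le> dist x y" using Z(3) by (simp add: pairwise_def)
      then have "ball x (\<epsilon> / 2) \<inter> ball y (\<epsilon> / 2) = {}" by (intro disjoint_ballI) simp
      then show "negligible (ball x (\<epsilon> / 2) \<inter> ball y (\<epsilon> / 2))" by simp
    qed
  qed auto
  also have "\<dots> \<le> measure lebesgue (\<Union>x\<in>S. ball x \<epsilon>)"
  proof (rule measure_mono_fmeasurable)
    show "(\<Union>z\<in>Z. ball z (\<epsilon> / 2)) \<subseteq> (\<Union>x\<in>S. ball x \<epsilon>)"
      using Z(2) \<epsilon> by (intro UN_mono) auto
    obtain R where R: "\<forall>x\<in>S. norm x \<le> R" using S by (auto simp: bounded_iff)
    have "(\<Union>x\<in>S. ball x \<epsilon>) \<subseteq> cball 0 (R + \<epsilon>)"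
    proof
      fix y assume "y \<in> (\<Union>x\<in>S. ball x \<epsilon>)"
      then obtain x where x: "x \<in> S" "dist x y < \<epsilon>" by auto
      have "norm y \<le> norm x + dist x y" by (metis dist_norm norm_minus_commute norm_triangle_sub)
      then show "y \<in> cball 0 (R + \<epsilon>)" using x R by fastforce
    qed
    then have "bounded (\<Union>x\<in>S. ball x \<epsilon>)" by (rule bounded_subset[OF bounded_cball])
    then show "(\<Union>x\<in>S. ball x \<epsilon>) \<in> lmeasurable" by (rule lmeasurable_open) auto
    show "(\<Union>z\<in>Z. ball z (\<epsilon> / 2)) \<in> sets lebesgue" using Z(1) by (intro sets.finite_UN) auto
  qed
  finally show ?thesis by simp
qed

text \<open>The closure of the domain without \<open>N\<close> is compact and consists of points of the domain and regular boundary
  points, and around each of them the formula is known for localised test functions.\<close>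

lemma green_form_away_from_singular:
  assumes dom: "bounded_domain_with_normal \<Omega> \<nu>" and F: "Ck_closure 1 \<Omega> F"
    and tang: "\<And>x. x \<in> regular_boundary \<Omega> \<Longrightarrow> F x \<bullet> \<nu> x = 0"
    and N: "open N" "frontier \<Omega> - regular_boundary \<Omega> \<subseteq> N"
    and \<phi>: "test_function \<phi> D" "\<And>x. x \<in> N \<Longrightarrow> \<phi> x = 0"
  shows "green_form \<Omega> F \<phi> D = 0"
proof -
  have \<Omega>: "open \<Omega>" "bounded \<Omega>" using dom by (auto simp: bounded_domain_with_normal_def)
  define K where "K = closure \<Omega> - N"
  have K: "compact K" using \<Omega>(2) N(1) by (simp add: K_def compact_diff)
  have "\<exists>s>0. \<forall>\<phi> D. test_function \<phi> D \<longrightarrow> (\<forall>x. x \<notin> ball a s \<longrightarrow> \<phi> x = 0) \<longrightarrow> green_form \<Omega> F \<phi> D = 0"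
    if "a \<in> K" for a
  proof (cases "a \<in> \<Omega>")
    case True
    then obtain s where s: "0 < s" "cball a s \<subseteq> \<Omega>" using \<Omega>(1) open_contains_cball by blast
    have "green_form \<Omega> F \<phi> D = 0" if "test_function \<phi> D" "\<forall>x. x \<notin> ball a s \<longrightarrow> \<phi> x = 0" for \<phi> D
      by (rule green_form_compact_support[OF \<Omega> F that(1) compact_cball s(2)]) (use that(2) in auto)
    then show ?thesis using s(1) by blast
  next
    case False
    then have "a \<in> regular_boundary \<Omega>"
      using that N(2) \<Omega>(1) by (auto simp: K_def frontier_def interior_open)
    then obtain U g g' where "open U" "a \<in> U" "\<forall>y\<in>U. (g has_derivative (\<lambda>h. g' y \<bullet> h)) (at y)"
      "continuous_on U g'" "\<forall>y\<in>U. g' y \<noteq> 0" "\<Omega> \<inter> U = {y\<in>U. g y < (0::real)}"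
      "\<forall>y\<in>U \<inter> frontier \<Omega>. F y \<bullet> g' y = 0"
      using tangential_field_chart[of \<Omega> \<nu> F a, OF dom tang] by blast
    then show ?thesis by (intro green_form_boundary_chart[OF \<Omega> F, of U a g g']) auto
  qed
  then have "\<forall>a\<in>K. \<exists>s>0. \<forall>\<phi> D. test_function \<phi> D \<longrightarrow> (\<forall>x. x \<notin> ball a s \<longrightarrow> \<phi> x = 0) \<longrightarrow> green_form \<Omega> F \<phi> D = 0"
    by blast
  from bchoice[OF this] obtain s where s: "\<forall>a\<in>K. 0 < s a \<and> (\<forall>\<phi> D. test_function \<phi> D \<longrightarrow>
      (\<forall>x. x \<notin> ball a (s a) \<longrightarrow> \<phi> x = 0) \<longrightarrow> green_form \<Omega> F \<phi> D = 0)" by (rule exE)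
  have "K \<subseteq> (\<Union>a\<in>K. ball a (s a / 2))" using s by auto
  then obtain A where A: "A \<subseteq> K" "finite A" "K \<subseteq> (\<Union>a\<in>A. ball a (s a / 2))"
    using compactE_image[OF K, of K "\<lambda>a. ball a (s a / 2)"] by auto
  show ?thesis
  proof (rule green_form_finite_cover[OF \<Omega> F A(2) _ _ \<phi>(1), of "\<lambda>a. s a / 2"])
    show "0 < s a / 2" if "a \<in> A" for a using s that A(1) by auto
    show "green_form \<Omega> F \<psi> E = 0"
      if "a \<in> A" "test_function \<psi> E" "\<And>x. x \<notin> ball a (2 * (s a / 2)) \<Longrightarrow> \<psi> x = 0" for a \<psi> E
      using s that A(1) by auto
    show "x \<in> (\<Union>a\<in>A. ball a (s a / 2))" if "x \<in> \<Omega>" "\<phi> x \<noteq> 0" for x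
    proof -
      have "x \<notin> N" using \<phi>(2) that(2) by blast
      then have "x \<in> K" using that(1) closure_subset[of \<Omega>] by (auto simp: K_def)
      then show ?thesis using A(3) by blast
    qed
  qed
qed

text \<open>With a cutoff around the singular boundary points at scale \<open>\<epsilon>\<close>, the two error terms, the defect
  of the cutoff and its gradient, are at most a constant times \<open>1 + 1 / \<epsilon>\<close> times
  the volume of the \<open>\<epsilon>\<close>-neighbourhood of these points. This tends to zero by the assumption on their content.\<close>

lemma divergence_theorem_tangential:
  fixes F :: "real ^ 'd \<Rightarrow> real ^ 'd"
  assumes dom: "bounded_domain_with_normal \<Omega> \<nu>" and F: "Ck_closure 1 \<Omega> F"
    and tang: "\<And>x. x \<in> regular_boundary \<Omega> \<Longrightarrow> F x \<bullet> \<nu> x = 0"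
  shows "(LINT x:\<Omega>|lborel. divergence F x) = 0"
proof -
  have \<Omega>: "open \<Omega>" "bounded \<Omega>" using dom by (auto simp: bounded_domain_with_normal_def)
  define S where "S = frontier \<Omega> - regular_boundary \<Omega>"
  have S: "compact S" unfolding S_def by (rule compact_singular_boundary[OF \<Omega>])
  obtain dv where dv: "continuous_on (closure \<Omega>) dv" "\<forall>x\<in>\<Omega>. dv x = divergence F x"
    using divergence_extends_continuously[OF \<Omega>(1) F] by (elim exE conjE)
  obtain A where A: "0 \<le> A" "\<forall>x\<in>closure \<Omega>. norm (dv x) \<le> A"
    using continuous_on_closure_bounded[OF \<Omega>(2) dv(1)] by blast
  obtain B where B: "0 \<le> B" "\<forall>x\<in>closure \<Omega>. norm (F x) \<le> B"
    using continuous_on_closure_bounded[OF \<Omega>(2), of F] F by auto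
  define m where "m \<epsilon> = measure lebesgue (\<Union>x\<in>S. ball x \<epsilon>) / \<epsilon>" for \<epsilon>
  have bound: "\<bar>LINT x:\<Omega>|lborel. divergence F x\<bar> \<le> (A * \<epsilon> + 8 * B) * 8 ^ CARD('d) * m \<epsilon>" if \<epsilon>: "0 < \<epsilon>" for \<epsilon>
  proof -
    have "S \<subseteq> (\<Union>x\<in>S. ball x \<epsilon>)" using \<epsilon> by auto
    then obtain Z0 where Z0: "Z0 \<subseteq> S" "finite Z0" "S \<subseteq> (\<Union>x\<in>Z0. ball x \<epsilon>)"
      using compactE_image[OF S, of S "\<lambda>x. ball x \<epsilon>"] by auto
    obtain Z where Z: "Z \<subseteq> Z0" "pairwise (\<lambda>x y. \<epsilon> \<le> dist x y) Z" "\<forall>a\<in>Z0. \<exists>z\<in>Z. dist z a < \<epsilon>"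
      using finite_separated_net[OF Z0(2) \<epsilon>] by blast
    have ZS: "finite Z" "Z \<subseteq> S" using Z Z0 finite_subset by auto
    obtain \<psi> D where \<psi>: "test_function \<psi> D" "\<forall>x. 0 \<le> \<psi> x \<and> \<psi> x \<le> 1" "\<forall>z\<in>Z. \<forall>x\<in>ball z (2 * \<epsilon>). \<psi> x = 0"
      "\<forall>x. 1 - \<psi> x \<le> (\<Sum>z\<in>Z. indicator (ball z (2 * (2 * \<epsilon>))) x)"
      "\<forall>x. norm (D x) \<le> 16 / (2 * \<epsilon>) * (\<Sum>z\<in>Z. indicator (ball z (2 * (2 * \<epsilon>))) x)"
      using cutoff_finite_balls[OF ZS(1), of "2 * \<epsilon>"] \<epsilon> by auto
    define w :: "real ^ 'd \<Rightarrow> real" where "w x = (\<Sum>z\<in>Z. indicator (ball z (4 * \<epsilon>)) x)" for x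
    have "green_form \<Omega> F \<psi> D = 0"
    proof (rule green_form_away_from_singular[OF dom F tang _ _ \<psi>(1)])
      show "open (\<Union>z\<in>Z. ball z (2 * \<epsilon>))" by blast
      show "frontier \<Omega> - regular_boundary \<Omega> \<subseteq> (\<Union>z\<in>Z. ball z (2 * \<epsilon>))"
      proof
        fix x assume "x \<in> frontier \<Omega> - regular_boundary \<Omega>"
        then obtain a where a: "a \<in> Z0" "dist a x < \<epsilon>" using Z0(3) by (auto simp: S_def)
        then obtain z where "z \<in> Z" "dist z a < \<epsilon>" using Z(3) by blast
        then show "x \<in> (\<Union>z\<in>Z. ball z (2 * \<epsilon>))" using a dist_triangle[of z x a] by force
      qed
    qed (use \<psi>(3) in auto)
    moreover have "(LINT x:\<Omega>|lborel. divergence F x) = green_form \<Omega> F (\<lambda>x. 1) (\<lambda>x. 0)"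
      by (simp add: green_form_def)
    ultimately have eq: "(LINT x:\<Omega>|lborel. divergence F x) = green_form \<Omega> F (\<lambda>x. 1 - \<psi> x) (\<lambda>x. 0 - D x)"
      using green_form_diff[OF \<Omega> F test_function_const \<psi>(1), of 1] by simp
    have fin: "emeasure lborel (ball z (4 * \<epsilon>)) < \<infinity>" for z :: "real ^ 'd"
      by (intro emeasure_bounded_finite) auto
    have "\<bar>LINT x:\<Omega>|lborel. divergence F x\<bar> \<le> (\<integral>x. (A + 8 * B / \<epsilon>) * w x \<partial>lborel)"
      unfolding eq unfolding green_form_def set_lebesgue_integral_def real_norm_def[symmetric]
    proof (rule Bochner_Integration.integral_norm_bound_integral)
      show "integrable lborel (\<lambda>x. indicator \<Omega> x *\<^sub>R ((1 - \<psi> x) * divergence F x + F x \<bullet> (0 - D x)))"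
        using green_form_integrable[OF \<Omega> F test_function_diff[OF test_function_const \<psi>(1), of 1]]
        by (simp add: set_integrable_def)
      show "integrable lborel (\<lambda>x. (A + 8 * B / \<epsilon>) * w x)"
        unfolding w_def using fin by (intro integrable_mult_right integrable_sum integrable_real_indicator) auto
      show "norm (indicator \<Omega> x *\<^sub>R ((1 - \<psi> x) * divergence F x + F x \<bullet> (0 - D x))) \<le> (A + 8 * B / \<epsilon>) * w x" for x
      proof (cases "x \<in> \<Omega>")
        case True
        then have x: "x \<in> closure \<Omega>" using closure_subset by blast
        have "\<bar>(1 - \<psi> x) * divergence F x\<bar> \<le> w x * A"
          unfolding abs_mult using \<psi>(2,4) A x dv(2) True by (intro mult_mono) (auto simp: w_def sum_nonneg)
        moreover have "\<bar>F x \<bullet> (0 - D x)\<bar> \<le> B * (8 / \<epsilon> * w x)"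
        proof -
          have "\<bar>F x \<bullet> (0 - D x)\<bar> \<le> norm (F x) * norm (D x)"
            using Cauchy_Schwarz_ineq2[of "F x" "0 - D x"] by simp
          also have "\<dots> \<le> B * (8 / \<epsilon> * w x)"
            using B x \<psi>(5)[rule_format, of x] by (intro mult_mono) (auto simp: w_def)
          finally show ?thesis .
        qed
        ultimately show ?thesis using True by (simp add: algebra_simps)
      next
        case False
        then show ?thesis using A B \<epsilon> by (auto simp: w_def intro!: mult_nonneg_nonneg add_nonneg_nonneg sum_nonneg)
      qed
    qed
    also have "\<dots> = (A + 8 * B / \<epsilon>) * (\<Sum>z\<in>Z. measure lebesgue (ball z (4 * \<epsilon>)))"
      unfolding w_def using fin by (subst integral_mult_right_zero, subst Bochner_Integration.integral_sum) (auto intro!: integrable_real_indicator)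
    also have "\<dots> \<le> (A + 8 * B / \<epsilon>) * (8 ^ CARD('d) * (m \<epsilon> * \<epsilon>))"
      using sum_measure_separated_balls[OF ZS Z(2) \<epsilon> compact_imp_bounded[OF S]] A B \<epsilon>
      by (intro mult_left_mono) (auto simp: m_def)
    also have "\<dots> = (A * \<epsilon> + 8 * B) * 8 ^ CARD('d) * m \<epsilon>"
      using \<epsilon> by (simp add: field_simps)
    finally show ?thesis .
  qed
  have "(m \<longlongrightarrow> 0) (at_right 0)"
    using dom by (simp add: bounded_domain_with_normal_def null_content_codim1_def m_def[abs_def] S_def)
  then have "((\<lambda>\<epsilon>. (A * \<epsilon> + 8 * B) * 8 ^ CARD('d) * m \<epsilon>) \<longlongrightarrow> (A * 0 + 8 * B) * 8 ^ CARD('d) * 0) (at_right 0)"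
    by (intro tendsto_intros)
  then have lim: "((\<lambda>\<epsilon>. (A * \<epsilon> + 8 * B) * 8 ^ CARD('d) * m \<epsilon>) \<longlongrightarrow> 0) (at_right 0)" by simp
  have "\<bar>LINT x:\<Omega>|lborel. divergence F x\<bar> \<le> 0"
    by (rule tendsto_le[OF _ lim tendsto_const])
       (auto simp: bound eventually_at_right_less intro!: eventually_mono[OF eventually_at_right_less[of 0]])
  then show ?thesis by simp
qed

section \<open>The discrete energy balance\<close>

text \<open>The second term of the right-hand side is cancelled in the momentum equation by the gradient of the kinetic
  energy, and the first one by the correction \<open>div(r u) u\<close>.\<close>

lemma convective_term_inner:
  assumes r: "r differentiable (at x)" and u: "u differentiable (at x)"
  shows "divergence_mat (\<lambda>y. (r y *\<^sub>R u y) \<otimes>\<^sub>v u y) x \<bullet> u x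
    = divergence (\<lambda>y. r y *\<^sub>R u y) x * (u x \<bullet> u x) + 1/2 * r x * (grad (\<lambda>y. (norm (u y))\<^sup>2) x \<bullet> u x)"
proof -
  have ui: "(\<lambda>y. u y $ i) differentiable (at x)" for i
    using u by (rule differentiable_vec_nth)
  have row: "divergence (\<lambda>y. ((r y *\<^sub>R u y) \<otimes>\<^sub>v u y) $ i) x
      = u x $ i * divergence (\<lambda>y. r y *\<^sub>R u y) x + r x * (\<Sum>j\<in>UNIV. partial_deriv j u x $ i * u x $ j)" for i
  proof -
    have "(\<lambda>y. ((r y *\<^sub>R u y) \<otimes>\<^sub>v u y) $ i) = (\<lambda>y. u y $ i *\<^sub>R (r y *\<^sub>R u y))"
      by (simp add: outer_def vec_eq_iff fun_eq_iff ac_simps)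
    then show ?thesis
      using divergence_scaleR[OF ui differentiable_scaleR[OF r u], of i]
      by (simp add: grad_def inner_vec_def partial_deriv_nth[OF u] sum_distrib_left ac_simps)
  qed
  have "divergence_mat (\<lambda>y. (r y *\<^sub>R u y) \<otimes>\<^sub>v u y) x \<bullet> u x
    = (\<Sum>i\<in>UNIV. (u x $ i * divergence (\<lambda>y. r y *\<^sub>R u y) x + r x * (\<Sum>j\<in>UNIV. partial_deriv j u x $ i * u x $ j)) * u x $ i)"
    by (simp add: divergence_mat_def inner_vec_def row)
  also have "\<dots> = divergence (\<lambda>y. r y *\<^sub>R u y) x * (u x \<bullet> u x)
      + r x * (\<Sum>i\<in>UNIV. \<Sum>j\<in>UNIV. partial_deriv j u x $ i * u x $ j * u x $ i)"
    by (simp add: inner_vec_def sum.distrib sum_distrib_left sum_distrib_right algebra_simps)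
  also have "(\<Sum>i\<in>UNIV. \<Sum>j\<in>UNIV. partial_deriv j u x $ i * u x $ j * u x $ i)
      = (\<Sum>j\<in>UNIV. (u x \<bullet> partial_deriv j u x) * u x $ j)"
    by (subst sum.swap) (simp add: inner_vec_def sum_distrib_left sum_distrib_right ac_simps)
  also have "\<dots> = 1/2 * (grad (\<lambda>y. (norm (u y))\<^sup>2) x \<bullet> u x)"
  proof -
    have "grad (\<lambda>y. u y \<bullet> u y) x $ j = 2 * (u x \<bullet> partial_deriv j u x)" for j
      using partial_deriv_inner[OF u u, of j] by (simp add: grad_def inner_commute)
    then show ?thesis
      by (simp add: power2_norm_eq_inner inner_vec_def[of "grad _ _"] sum_distrib_left)
  qed
  finally show ?thesis by simp
qed

lemma power2_norm_jacobian:
  fixes u :: "real ^ 'd \<Rightarrow> real ^ 'd"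
  shows "(norm (jacobian u (at x)))\<^sup>2 = (\<Sum>j\<in>UNIV. (norm (partial_deriv j u x))\<^sup>2)"
proof -
  have "(norm (jacobian u (at x)))\<^sup>2 = (\<Sum>i\<in>UNIV. \<Sum>j\<in>UNIV. (partial_deriv j u x $ i)\<^sup>2)"
    unfolding power2_norm_eq_inner
    by (simp add: inner_vec_def jacobian_def matrix_def partial_deriv_def power2_eq_square)
  then show ?thesis
    unfolding power2_norm_eq_inner inner_vec_def[of "partial_deriv _ _ _"]
    by (subst (asm) sum.swap) (simp add: power2_eq_square)
qed

text \<open>The product rule for \<open>\<partial>\<^sub>i (\<partial>\<^sub>i u \<bullet> u)\<close>, summed over \<open>i\<close>. The functions \<open>G i\<close> represent the partial
  derivatives of \<open>u\<close>; this leaves room for extensions that are defined on the boundary.\<close>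

lemma divergence_viscous_flux:
  assumes \<Omega>: "open \<Omega>" "x \<in> \<Omega>" and u: "\<And>y. y \<in> \<Omega> \<Longrightarrow> u differentiable (at y)"
    and G: "\<And>i. G i differentiable (at x)" "\<And>i y. y \<in> \<Omega> \<Longrightarrow> G i y = partial_deriv i u y"
  shows "divergence (\<lambda>y. \<chi> i. G i y \<bullet> u y) x = (norm (jacobian u (at x)))\<^sup>2 + vec_laplacian u x \<bullet> u x"
proof -
  have "laplacian (\<lambda>y. u y $ j) x = (\<Sum>i\<in>UNIV. partial_deriv i (G i) x $ j)" for j
    unfolding laplacian_def
  proof (rule sum.cong[OF refl])
    fix i
    have "(\<lambda>y. G i y $ j) differentiable (at x)"
      using G(1) by (rule differentiable_vec_nth)
    then have "partial_deriv i (\<lambda>y. G i y $ j) x = partial_deriv i (partial_deriv i (\<lambda>y. u y $ j)) x"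
      by (rule partial_deriv_cong_open[OF \<Omega>]) (simp add: G(2) partial_deriv_nth[OF u])
    then show "partial_deriv i (partial_deriv i (\<lambda>y. u y $ j)) x = partial_deriv i (G i) x $ j"
      by (simp add: partial_deriv_nth[OF G(1)])
  qed
  then have lap: "vec_laplacian u x = (\<Sum>i\<in>UNIV. partial_deriv i (G i) x)"
    by (simp add: vec_laplacian_def vec_eq_iff)
  have "divergence (\<lambda>y. \<chi> i. G i y \<bullet> u y) x = (\<Sum>i\<in>UNIV. partial_deriv i (\<lambda>y. G i y \<bullet> u y) x)"
    by (simp add: divergence_def)
  also have "\<dots> = (\<Sum>i\<in>UNIV. (norm (partial_deriv i u x))\<^sup>2) + (\<Sum>i\<in>UNIV. partial_deriv i (G i) x) \<bullet> u x"
    by (simp add: partial_deriv_inner[OF G(1) u[OF \<Omega>(2)]] G(2)[OF \<Omega>(2)] sum.distrib power2_norm_eq_inner inner_sum_left)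
  finally show ?thesis by (simp add: lap power2_norm_jacobian)
qed

lemma diff_quotient_mult: "diff_quotient W r s * (s - r) = W s - W r"
  by (simp add: diff_quotient_def)

text \<open>The discrete chain rule for the square of the norm, used for \<open>v\<close> and for \<open>q\<close>.\<close>

lemma diff_inner_midpt:
  fixes f :: "nat \<Rightarrow> 'a \<Rightarrow> 'b::real_inner"
  shows "(f (Suc n) x - f n x) \<bullet> midpt f n x = ((norm (f (Suc n) x))\<^sup>2 - (norm (f n x))\<^sup>2) / 2"
  by (simp add: midpt_def power2_norm_eq_inner inner_diff_left inner_add_right inner_diff_right inner_commute)

text \<open>The momentum equation is tested with the midpoint velocity, the mass equation with the midpoint
  of \<open>\<tau>\<close>, and \<open>\<tau>\<close> is then eliminated by means of its defining equation.\<close>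

lemma energy_balance_pointwise:
  fixes \<rho> \<tau> :: "nat \<Rightarrow> real ^ 'd \<Rightarrow> real" and v q :: "nat \<Rightarrow> real ^ 'd \<Rightarrow> real ^ 'd"
  assumes \<Omega>: "open \<Omega>" and x: "x \<in> \<Omega>" and k: "0 < k"
    and diffble: "\<And>y. y \<in> \<Omega> \<Longrightarrow> \<rho> n differentiable (at y)" "\<And>y. y \<in> \<Omega> \<Longrightarrow> \<rho> (Suc n) differentiable (at y)"
      "\<And>y. y \<in> \<Omega> \<Longrightarrow> midpt v n differentiable (at y)"
      "midpt \<tau> n differentiable (at x)" "midpt q n differentiable (at x)"
    and G: "\<And>i. G i differentiable (at x)" "\<And>i y. y \<in> \<Omega> \<Longrightarrow> G i y = partial_deriv i (midpt v n) y"
    and q: "q n x = grad (\<rho> n) x" "q (Suc n) x = grad (\<rho> (Suc n)) x"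
    and mass: "0 = (\<rho> (Suc n) x - \<rho> n x) / k
            + divergence (\<lambda>y. midpt \<rho> n y *\<^sub>R midpt v n y) x"
    and momentum: "0 = midpt \<rho> n x *\<^sub>R ((v (Suc n) x - v n x) /\<^sub>R k)
            + divergence_mat (\<lambda>y. (midpt \<rho> n y *\<^sub>R midpt v n y) \<otimes>\<^sub>v midpt v n y) x
            - divergence (\<lambda>y. midpt \<rho> n y *\<^sub>R midpt v n y) x *\<^sub>R midpt v n x
            + midpt \<rho> n x *\<^sub>R grad (midpt \<tau> n) x
            - (1/2 * midpt \<rho> n x) *\<^sub>R grad (\<lambda>y. (norm (midpt v n y))\<^sup>2) x
            - \<mu> *\<^sub>R vec_laplacian (midpt v n) x"
    and potential: "0 = midpt \<tau> n x - diff_quotient W (\<rho> n x) (\<rho> (Suc n) x)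
            + \<gamma> * divergence (midpt q n) x
            - 1/4 * ((norm (v (Suc n) x))\<^sup>2 + (norm (v n x))\<^sup>2)"
  shows "(W (\<rho> (Suc n) x) + 1/2 * \<rho> (Suc n) x * (norm (v (Suc n) x))\<^sup>2 + \<gamma>/2 * (norm (q (Suc n) x))\<^sup>2)
       - (W (\<rho> n x) + 1/2 * \<rho> n x * (norm (v n x))\<^sup>2 + \<gamma>/2 * (norm (q n x))\<^sup>2)
     = divergence (\<lambda>y. (- k) *\<^sub>R (midpt \<tau> n y *\<^sub>R (midpt \<rho> n y *\<^sub>R midpt v n y))
          + (\<gamma> *\<^sub>R ((\<rho> (Suc n) y - \<rho> n y) *\<^sub>R midpt q n y)
          + (k * \<mu>) *\<^sub>R (\<chi> i. G i y \<bullet> midpt v n y))) x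
       - k * \<mu> * (norm (jacobian (midpt v n) (at x)))\<^sup>2"
proof -
  define r where "r = midpt \<rho> n"
  define u where "u = midpt v n"
  define s where "s = midpt \<tau> n"
  define p where "p = midpt q n"
  define d where "d y = \<rho> (Suc n) y - \<rho> n y" for y
  define dru where "dru = divergence (\<lambda>y. r y *\<^sub>R u y) x"
  define L where "L = vec_laplacian u x \<bullet> u x"
  define a0 where "a0 = (norm (v n x))\<^sup>2"
  define a1 where "a1 = (norm (v (Suc n) x))\<^sup>2"
  define Fv where "Fv y = (\<chi> i. G i y \<bullet> u y)" for y
  have r: "r differentiable (at x)"
    unfolding r_def midpt_def[abs_def] using diffble(1,2)[OF x] by (intro differentiable_scaleR differentiable_add) simp_all
  have u: "\<And>y. y \<in> \<Omega> \<Longrightarrow> u differentiable (at y)" "u differentiable (at x)"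
    using diffble(3) x by (simp_all add: u_def)
  have s: "s differentiable (at x)" and p: "p differentiable (at x)" using diffble by (simp_all add: s_def p_def)
  have d: "d differentiable (at x)" unfolding d_def[abs_def] by (intro differentiable_diff diffble x)
  have ru: "(\<lambda>y. r y *\<^sub>R u y) differentiable (at x)" by (intro differentiable_scaleR r u)
  have Fv: "Fv differentiable (at x)"
  proof -
    have "(\<lambda>y. G i y \<bullet> u y) differentiable (at x)" for i by (intro differentiable_inner G u)
    then have "(\<lambda>y. \<Sum>i\<in>UNIV. (G i y \<bullet> u y) *\<^sub>R axis i (1::real)) differentiable (at x)"
      by (intro differentiable_sum differentiable_scaleR) simp_all
    moreover have "(\<Sum>i\<in>UNIV. (G i y \<bullet> u y) *\<^sub>R axis i 1) = Fv y" for y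
      by (simp add: Fv_def vec_eq_iff axis_def if_distrib cong: if_cong)
    ultimately show ?thesis by simp
  qed
  have div_s: "divergence (\<lambda>y. s y *\<^sub>R (r y *\<^sub>R u y)) x = s x * dru + r x * (grad s x \<bullet> u x)"
    unfolding divergence_scaleR[OF s ru] dru_def by simp
  have grad_d: "grad d x = q (Suc n) x - q n x"
  proof -
    have "d = (\<lambda>y. \<rho> (Suc n) y + (- 1) *\<^sub>R \<rho> n y)" by (simp add: d_def fun_eq_iff)
    then have "partial_deriv i d x = partial_deriv i (\<rho> (Suc n)) x - partial_deriv i (\<rho> n) x" for i
      using partial_deriv_add[OF diffble(2)[OF x] differentiable_scaleR[OF differentiable_const diffble(1)[OF x]], of i "- 1"]
        partial_deriv_cmul[OF diffble(1)[OF x], of i "- 1"] by simp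
    then show ?thesis by (simp add: q grad_def vec_eq_iff)
  qed
  have div_d: "divergence (\<lambda>y. d y *\<^sub>R p y) x
      = d x * divergence p x + ((norm (q (Suc n) x))\<^sup>2 - (norm (q n x))\<^sup>2) / 2"
    unfolding divergence_scaleR[OF d p] grad_d by (simp add: p_def diff_inner_midpt)
  have div_v: "divergence Fv x = (norm (jacobian u (at x)))\<^sup>2 + L"
    unfolding Fv_def[abs_def] L_def by (rule divergence_viscous_flux[OF \<Omega> x u(1) G(1)]) (simp_all add: G(2) u_def)
  have div_all: "divergence (\<lambda>y. (- k) *\<^sub>R (s y *\<^sub>R (r y *\<^sub>R u y)) + (\<gamma> *\<^sub>R (d y *\<^sub>R p y) + (k * \<mu>) *\<^sub>R Fv y)) x
    = - k * (s x * dru + r x * (grad s x \<bullet> u x))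
      + (\<gamma> * (d x * divergence p x + ((norm (q (Suc n) x))\<^sup>2 - (norm (q n x))\<^sup>2) / 2)
      + k * \<mu> * ((norm (jacobian u (at x)))\<^sup>2 + L))"
  proof -
    have D1: "(\<lambda>y. s y *\<^sub>R (r y *\<^sub>R u y)) differentiable (at x)" and D2: "(\<lambda>y. d y *\<^sub>R p y) differentiable (at x)"
      by (intro differentiable_scaleR s ru d p)+
    show ?thesis
      unfolding div_s[symmetric] div_d[symmetric] div_v[symmetric]
      by (subst divergence_add, (intro differentiable_add differentiable_scaleR differentiable_const D1 D2 Fv)+)+
         (simp only: divergence_cmul[OF D1] divergence_cmul[OF D2] divergence_cmul[OF Fv])
  qed
  \<comment> \<open>The momentum equation tested with \<open>u\<close>, after cancellation of the convective terms.\<close>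
  have M: "r x * ((a1 - a0) / (2 * k)) + r x * (grad s x \<bullet> u x) - \<mu> * L = 0"
  proof -
    define w where "w = (v (Suc n) x - v n x) /\<^sub>R k"
    have "(v (Suc n) x - v n x) \<bullet> u x = (a1 - a0) / 2"
      unfolding u_def a0_def a1_def by (rule diff_inner_midpt)
    then have 1: "w \<bullet> u x = (a1 - a0) / (2 * k)"
      unfolding w_def inner_scaleR_left by (simp only:) (use k in \<open>simp add: field_simps\<close>)
    have 2: "divergence_mat (\<lambda>y. (r y *\<^sub>R u y) \<otimes>\<^sub>v u y) x \<bullet> u x
        = dru * (u x \<bullet> u x) + 1/2 * r x * (grad (\<lambda>y. (norm (u y))\<^sup>2) x \<bullet> u x)"
      unfolding dru_def by (rule convective_term_inner[OF r u(2)])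
    have "r x *\<^sub>R w + divergence_mat (\<lambda>y. (r y *\<^sub>R u y) \<otimes>\<^sub>v u y) x - dru *\<^sub>R u x + r x *\<^sub>R grad s x
        - (1/2 * r x) *\<^sub>R grad (\<lambda>y. (norm (u y))\<^sup>2) x - \<mu> *\<^sub>R vec_laplacian u x = 0"
      unfolding r_def u_def s_def dru_def w_def by (rule momentum[symmetric])
    then have "(r x *\<^sub>R w + divergence_mat (\<lambda>y. (r y *\<^sub>R u y) \<otimes>\<^sub>v u y) x - dru *\<^sub>R u x + r x *\<^sub>R grad s x
        - (1/2 * r x) *\<^sub>R grad (\<lambda>y. (norm (u y))\<^sup>2) x - \<mu> *\<^sub>R vec_laplacian u x) \<bullet> u x = 0"
      by (simp only: inner_zero_left)
    then show ?thesis
      unfolding inner_diff_left inner_add_left inner_scaleR_left 1 2 L_def by simp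
  qed
  have "r x * (grad s x \<bullet> u x) = \<mu> * L - r x * ((a1 - a0) / (2 * k))" using M by linarith
  then have M': "k * (r x * (grad s x \<bullet> u x)) = k * \<mu> * L - r x * (a1 - a0) / 2"
    using k by (simp add: field_simps)
  have "0 = d x / k + dru"
    unfolding d_def dru_def r_def u_def by (rule mass)
  then have mass': "k * dru = - d x"
    using k by (simp add: field_simps)
  \<comment> \<open>The equation for \<open>\<tau>\<close> tested with \<open>d\<close>: the difference quotient becomes an exact increment of \<open>W\<close>.\<close>
  have P: "s x * d x = W (\<rho> (Suc n) x) - W (\<rho> n x) - \<gamma> * divergence p x * d x + 1/4 * (a1 + a0) * d x"
  proof -
    have "0 = s x - diff_quotient W (\<rho> n x) (\<rho> (Suc n) x) + \<gamma> * divergence p x - 1/4 * (a1 + a0)"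
      unfolding s_def p_def a0_def a1_def by (rule potential)
    then have "s x = diff_quotient W (\<rho> n x) (\<rho> (Suc n) x) - \<gamma> * divergence p x + 1/4 * (a1 + a0)"
      by linarith
    moreover have "diff_quotient W (\<rho> n x) (\<rho> (Suc n) x) * d x = W (\<rho> (Suc n) x) - W (\<rho> n x)"
      unfolding d_def by (rule diff_quotient_mult)
    ultimately show ?thesis by (simp only: distrib_right left_diff_distrib)
  qed
  have r_eq: "r x = (\<rho> n x + \<rho> (Suc n) x) / 2" by (simp add: r_def midpt_def)
  have "- k * (s x * dru + r x * (grad s x \<bullet> u x)) = - (s x * (k * dru)) - k * (r x * (grad s x \<bullet> u x))"
    by (simp add: algebra_simps)
  also have "\<dots> = s x * d x - k * \<mu> * L + r x * (a1 - a0) / 2" unfolding mass' M' by simp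
  finally have main: "- k * (s x * dru + r x * (grad s x \<bullet> u x))
    = W (\<rho> (Suc n) x) - W (\<rho> n x) - \<gamma> * divergence p x * d x + 1/4 * (a1 + a0) * d x - k * \<mu> * L + r x * (a1 - a0) / 2"
    unfolding P by simp
  have "(W (\<rho> (Suc n) x) + 1/2 * \<rho> (Suc n) x * a1 + \<gamma>/2 * (norm (q (Suc n) x))\<^sup>2)
       - (W (\<rho> n x) + 1/2 * \<rho> n x * a0 + \<gamma>/2 * (norm (q n x))\<^sup>2)
     = divergence (\<lambda>y. (- k) *\<^sub>R (s y *\<^sub>R (r y *\<^sub>R u y)) + (\<gamma> *\<^sub>R (d y *\<^sub>R p y) + (k * \<mu>) *\<^sub>R Fv y)) x
       - k * \<mu> * (norm (jacobian u (at x)))\<^sup>2"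
    unfolding div_all unfolding main unfolding r_eq by (simp add: d_def field_simps)
  then show ?thesis
    unfolding r_def u_def s_def p_def d_def Fv_def a0_def a1_def .
qed

lemma C2_closure_imp_C1: "Ck_closure 2 \<Omega> f \<Longrightarrow> Ck_closure 1 \<Omega> f"
  unfolding numeral_2_eq_2 One_nat_def by (rule Ck_closure_Suc_D)

text \<open>The pointwise balance is integrated over the domain, and the flux disappears by the divergence theorem.\<close>

lemma energy_step:
  fixes \<rho> \<tau> :: "nat \<Rightarrow> real ^ 'd \<Rightarrow> real" and v q :: "nat \<Rightarrow> real ^ 'd \<Rightarrow> real ^ 'd"
  assumes dom: "bounded_domain_with_normal \<Omega> \<nu>" and W: "continuous_on I W" and k: "0 < k"
    and smooth: "\<And>m. m \<in> {n, Suc n} \<Longrightarrow> Ck_closure 2 \<Omega> (\<rho> m)" "\<And>m. m \<in> {n, Suc n} \<Longrightarrow> Ck_closure 2 \<Omega> (v m)"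
      "\<And>m. m \<in> {n, Suc n} \<Longrightarrow> Ck_closure 1 \<Omega> (\<tau> m)" "\<And>m. m \<in> {n, Suc n} \<Longrightarrow> Ck_closure 1 \<Omega> (q m)"
    and admissible: "\<And>m. m \<in> {n, Suc n} \<Longrightarrow> \<rho> m ` closure \<Omega> \<subseteq> I"
    and bdry: "\<And>m x. m \<in> {n, Suc n} \<Longrightarrow> x \<in> frontier \<Omega> \<Longrightarrow> v m x = 0"
      "\<And>m x. m \<in> {n, Suc n} \<Longrightarrow> x \<in> regular_boundary \<Omega> \<Longrightarrow> q m x \<bullet> \<nu> x = 0"
    and q: "\<And>m x. m \<in> {n, Suc n} \<Longrightarrow> x \<in> \<Omega> \<Longrightarrow> q m x = grad (\<rho> m) x"
    and mass: "\<And>x. x \<in> \<Omega> \<Longrightarrow> 0 = (\<rho> (Suc n) x - \<rho> n x) / k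
            + divergence (\<lambda>y. midpt \<rho> n y *\<^sub>R midpt v n y) x"
    and momentum: "\<And>x. x \<in> \<Omega> \<Longrightarrow> 0 = midpt \<rho> n x *\<^sub>R ((v (Suc n) x - v n x) /\<^sub>R k)
            + divergence_mat (\<lambda>y. (midpt \<rho> n y *\<^sub>R midpt v n y) \<otimes>\<^sub>v midpt v n y) x
            - divergence (\<lambda>y. midpt \<rho> n y *\<^sub>R midpt v n y) x *\<^sub>R midpt v n x
            + midpt \<rho> n x *\<^sub>R grad (midpt \<tau> n) x
            - (1/2 * midpt \<rho> n x) *\<^sub>R grad (\<lambda>y. (norm (midpt v n y))\<^sup>2) x
            - \<mu> *\<^sub>R vec_laplacian (midpt v n) x"
    and potential: "\<And>x. x \<in> \<Omega> \<Longrightarrow> 0 = midpt \<tau> n x - diff_quotient W (\<rho> n x) (\<rho> (Suc n) x)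
            + \<gamma> * divergence (midpt q n) x
            - 1/4 * ((norm (v (Suc n) x))\<^sup>2 + (norm (v n x))\<^sup>2)"
  shows "total_energy \<Omega> W \<gamma> (\<rho> (Suc n)) (v (Suc n)) (q (Suc n)) = total_energy \<Omega> W \<gamma> (\<rho> n) (v n) (q n)
    - k * \<mu> * (LINT x:\<Omega>|lborel. (norm (jacobian (midpt v n) (at x)))\<^sup>2)"
proof -
  have \<Omega>: "open \<Omega>" "bounded \<Omega>" using dom by (auto simp: bounded_domain_with_normal_def)
  have \<rho>1: "Ck_closure 1 \<Omega> (\<rho> n)" "Ck_closure 1 \<Omega> (\<rho> (Suc n))"
    and v1: "Ck_closure 1 \<Omega> (v n)" "Ck_closure 1 \<Omega> (v (Suc n))"
    by (rule C2_closure_imp_C1, rule smooth, simp)+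
  define u where "u = midpt v n"
  have C1: "Ck_closure 1 \<Omega> (midpt \<rho> n)" "Ck_closure 1 \<Omega> u" "Ck_closure 1 \<Omega> (midpt \<tau> n)" "Ck_closure 1 \<Omega> (midpt q n)"
    unfolding u_def by (intro C1_closure_midpt \<Omega>(1) \<rho>1 v1 smooth; simp)+
  obtain G0 where G0: "\<forall>i. Ck_closure 1 \<Omega> (G0 i) \<and> (\<forall>x\<in>\<Omega>. G0 i x = partial_deriv i (v n) x)"
    using Ck_closure_partial_derivs[of 1 \<Omega> "v n"] smooth(2)[of n] by (simp only: numeral_2_eq_2 One_nat_def) auto
  obtain G1 where G1: "\<forall>i. Ck_closure 1 \<Omega> (G1 i) \<and> (\<forall>x\<in>\<Omega>. G1 i x = partial_deriv i (v (Suc n)) x)"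
    using Ck_closure_partial_derivs[of 1 \<Omega> "v (Suc n)"] smooth(2)[of "Suc n"] by (simp only: numeral_2_eq_2 One_nat_def) auto
  \<comment> \<open>The flux has to be defined on the closed domain, so the partial derivatives of the velocity are
      replaced by their continuous extensions.\<close>
  define G where "G i y = (1/2) *\<^sub>R (G0 i y + G1 i y)" for i y
  have G: "Ck_closure 1 \<Omega> (G i)" for i
    unfolding G_def[abs_def] by (intro C1_closure_cmul C1_closure_add \<Omega>(1)) (use G0 G1 in blast)+
  have G_eq: "G i y = partial_deriv i u y" if "y \<in> \<Omega>" for i y
    unfolding u_def midpt_def[abs_def] G_def
    using G0 G1 that C1_closureD(2)[OF v1(1) \<Omega>(1) that] C1_closureD(2)[OF v1(2) \<Omega>(1) that]
    by (simp only: partial_deriv_cmul differentiable_add partial_deriv_add)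
  define H where "H y = (- k) *\<^sub>R (midpt \<tau> n y *\<^sub>R (midpt \<rho> n y *\<^sub>R u y))
          + (\<gamma> *\<^sub>R ((\<rho> (Suc n) y - \<rho> n y) *\<^sub>R midpt q n y)
          + (k * \<mu>) *\<^sub>R (\<chi> i. G i y \<bullet> u y))" for y
  have d1: "Ck_closure 1 \<Omega> (\<lambda>y. \<rho> (Suc n) y - \<rho> n y)"
    using C1_closure_add[OF \<Omega>(1) \<rho>1(2) C1_closure_cmul[OF \<Omega>(1) \<rho>1(1), of "- 1"]] by (simp del: One_nat_def)
  have H: "Ck_closure 1 \<Omega> H"
    unfolding H_def[abs_def]
    by (intro C1_closure_add C1_closure_cmul C1_closure_scaleR C1_closure_vec C1_closure_inner \<Omega>(1) C1 d1 G)
  have tang: "H x \<bullet> \<nu> x = 0" if "x \<in> regular_boundary \<Omega>" for x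
  proof -
    have "x \<in> frontier \<Omega>" using that by (simp add: regular_boundary_def)
    then have "u x = 0" using bdry(1) by (simp add: u_def midpt_def)
    moreover have "midpt q n x \<bullet> \<nu> x = 0" using bdry(2)[OF _ that] by (simp add: midpt_def inner_add_left)
    moreover have "(\<chi> i. G i x \<bullet> (0 :: real ^ 'd)) = 0" by (simp add: vec_eq_iff)
    ultimately show ?thesis by (simp add: H_def inner_add_left)
  qed
  have "(LINT x:\<Omega>|lborel. divergence H x) = 0"
    by (rule divergence_theorem_tangential[OF dom H tang])
  obtain dv where dv: "continuous_on (closure \<Omega>) dv" "\<forall>x\<in>\<Omega>. dv x = divergence H x"
    using divergence_extends_continuously[OF \<Omega>(1) H] by (elim exE conjE)
  define e where "e m x = W (\<rho> m x) + 1/2 * \<rho> m x * (norm (v m x))\<^sup>2 + \<gamma>/2 * (norm (q m x))\<^sup>2" for m x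
  define J where "J x = (norm (jacobian u (at x)))\<^sup>2" for x
  have balance: "e (Suc n) x - e n x = divergence H x - k * \<mu> * J x" if x: "x \<in> \<Omega>" for x
    unfolding e_def J_def H_def[abs_def] u_def
  proof (rule energy_balance_pointwise[OF \<Omega>(1) x k])
    show "\<rho> n differentiable at y" "\<rho> (Suc n) differentiable at y" "midpt v n differentiable at y" if "y \<in> \<Omega>" for y
      using C1_closureD(2)[OF \<rho>1(1) \<Omega>(1) that] C1_closureD(2)[OF \<rho>1(2) \<Omega>(1) that]
        C1_closureD(2)[OF C1(2) \<Omega>(1) that] by (simp_all add: u_def)
    show "midpt \<tau> n differentiable at x" "midpt q n differentiable at x"
      by (rule C1_closureD(2)[OF C1(3) \<Omega>(1) x] C1_closureD(2)[OF C1(4) \<Omega>(1) x])+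
    show "G i differentiable at x" for i by (rule C1_closureD(2)[OF G \<Omega>(1) x])
    show "G i y = partial_deriv i (midpt v n) y" if "y \<in> \<Omega>" for i y using G_eq[OF that] by (simp add: u_def)
    show "q n x = grad (\<rho> n) x" "q (Suc n) x = grad (\<rho> (Suc n)) x" using q x by auto
  qed (rule mass momentum potential, rule x)+
  have int_e: "set_integrable lborel \<Omega> (e m)" if m: "m \<in> {n, Suc n}" for m
  proof (rule set_integrable_continuous_closure[OF \<Omega>])
    have c: "continuous_on (closure \<Omega>) (\<rho> m)" "continuous_on (closure \<Omega>) (v m)" "continuous_on (closure \<Omega>) (q m)"
      using m \<rho>1 v1 smooth(4)[OF m] C1_closureD(1)[OF _ \<Omega>(1)] by blast+
    moreover have "continuous_on (closure \<Omega>) (\<lambda>x. W (\<rho> m x))"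
      using continuous_on_compose2[OF W c(1) admissible[OF m]] .
    ultimately show "continuous_on (closure \<Omega>) (e m)" unfolding e_def[abs_def] by (intro continuous_intros)
  qed simp
  have int_J: "set_integrable lborel \<Omega> J"
  proof (rule set_integrable_continuous_closure[OF \<Omega>])
    show "continuous_on (closure \<Omega>) (\<lambda>x. \<Sum>i\<in>UNIV. (norm (G i x))\<^sup>2)"
      by (intro continuous_intros C1_closureD(1)[OF G \<Omega>(1)])
    show "J x = (\<Sum>i\<in>UNIV. (norm (G i x))\<^sup>2)" if "x \<in> \<Omega>" for x
      by (simp add: J_def power2_norm_jacobian G_eq[OF that])
  qed
  have int_H: "set_integrable lborel \<Omega> (divergence H)"
    by (rule set_integrable_continuous_closure[OF \<Omega> dv(1)]) (use dv(2) in simp)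
  have "(LINT x:\<Omega>|lborel. e (Suc n) x) - (LINT x:\<Omega>|lborel. e n x) = (LINT x:\<Omega>|lborel. e (Suc n) x - e n x)"
    using int_e by (simp add: set_integral_diff(2))
  also have "\<dots> = (LINT x:\<Omega>|lborel. divergence H x - k * \<mu> * J x)"
    using balance \<Omega>(1) by (intro set_lebesgue_integral_cong) auto
  also have "\<dots> = (LINT x:\<Omega>|lborel. divergence H x) - k * \<mu> * (LINT x:\<Omega>|lborel. J x)"
    using int_H int_J by (subst set_integral_diff(2)) (auto intro: set_integrable_mult_right)
  also have "\<dots> = - k * \<mu> * (LINT x:\<Omega>|lborel. J x)"
    using \<open>(LINT x:\<Omega>|lborel. divergence H x) = 0\<close> by simp
  finally show ?thesis
    by (simp add: total_energy_def e_def J_def u_def)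
qed

lemma double_well_continuous_on:
  assumes "double_well I W"
  shows "continuous_on I W"
proof -
  have "W field_differentiable at r" if "r \<in> I" for r
    using assms that unfolding double_well_def by (metis funpow_0)
  then show ?thesis
    by (meson continuous_at_imp_continuous_on field_differentiable_imp_continuous_at)
qed

theorem theorem4p1:
  fixes \<Omega> :: "(real ^ 'd) set" and \<nu> :: "real ^ 'd \<Rightarrow> real ^ 'd"
    and I :: "real set" and W :: "real \<Rightarrow> real" and \<mu> \<gamma> T :: real
    and N :: nat and t k :: "nat \<Rightarrow> real"
    and \<rho> \<tau> :: "nat \<Rightarrow> real ^ 'd \<Rightarrow> real"
    and v q :: "nat \<Rightarrow> real ^ 'd \<Rightarrow> real ^ 'd"
  assumes dim: "CARD('d) \<in> {1, 2, 3}"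
    and domain: "bounded_domain_with_normal \<Omega> \<nu>"
    and W: "double_well I W"
    and mu: "\<mu> \<ge> 0"
    and partition: "t 0 = 0" "t N = T" "\<And>n. n < N \<Longrightarrow> t n < t (Suc n)"
    and step: "\<And>n. n < N \<Longrightarrow> k n = t (Suc n) - t n"
    and smooth: "\<And>n. n \<le> N \<Longrightarrow> Ck_closure 2 \<Omega> (\<rho> n)"
                "\<And>n. n \<le> N \<Longrightarrow> Ck_closure 2 \<Omega> (v n)"
                "\<And>n. n \<le> N \<Longrightarrow> Ck_closure 1 \<Omega> (\<tau> n)"
                "\<And>n. n \<le> N \<Longrightarrow> Ck_closure 1 \<Omega> (q n)"
    and admissible: "\<And>n. n \<le> N \<Longrightarrow> \<rho> n ` closure \<Omega> \<subseteq> I"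
    and init: "\<And>x. x \<in> \<Omega> \<Longrightarrow> q 0 x = grad (\<rho> 0) x"
    and init_bdry: "\<And>x. x \<in> frontier \<Omega> \<Longrightarrow> v 0 x = 0"
                   "\<And>x. x \<in> regular_boundary \<Omega> \<Longrightarrow> q 0 x \<bullet> \<nu> x = 0"
    and bdry: "\<And>n x. n < N \<Longrightarrow> x \<in> frontier \<Omega> \<Longrightarrow> v (Suc n) x = 0"
              "\<And>n x. n < N \<Longrightarrow> x \<in> regular_boundary \<Omega> \<Longrightarrow> q (Suc n) x \<bullet> \<nu> x = 0"
    and mass: "\<And>n x. n < N \<Longrightarrow> x \<in> \<Omega> \<Longrightarrow>
        0 = (\<rho> (Suc n) x - \<rho> n x) / k n
            + divergence (\<lambda>y. midpt \<rho> n y *\<^sub>R midpt v n y) x"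
    and momentum: "\<And>n x. n < N \<Longrightarrow> x \<in> \<Omega> \<Longrightarrow>
        0 = midpt \<rho> n x *\<^sub>R ((v (Suc n) x - v n x) /\<^sub>R k n)
            + divergence_mat (\<lambda>y. (midpt \<rho> n y *\<^sub>R midpt v n y) \<otimes>\<^sub>v midpt v n y) x
            - divergence (\<lambda>y. midpt \<rho> n y *\<^sub>R midpt v n y) x *\<^sub>R midpt v n x
            + midpt \<rho> n x *\<^sub>R grad (midpt \<tau> n) x
            - (1/2 * midpt \<rho> n x) *\<^sub>R grad (\<lambda>y. (norm (midpt v n y))\<^sup>2) x
            - \<mu> *\<^sub>R vec_laplacian (midpt v n) x"
    and potential: "\<And>n x. n < N \<Longrightarrow> x \<in> \<Omega> \<Longrightarrow>
        0 = midpt \<tau> n x - diff_quotient W (\<rho> n x) (\<rho> (Suc n) x)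
            + \<gamma> * divergence (midpt q n) x
            - 1/4 * ((norm (v (Suc n) x))\<^sup>2 + (norm (v n x))\<^sup>2)"
    and aux_gradient: "\<And>n x. n < N \<Longrightarrow> x \<in> \<Omega> \<Longrightarrow> 0 = q (Suc n) x - grad (\<rho> (Suc n)) x"
  shows "\<forall>n\<le>N. total_energy \<Omega> W \<gamma> (\<rho> n) (v n) (q n) =
           total_energy \<Omega> W \<gamma> (\<rho> 0) (v 0) (q 0)
           - \<mu> * (\<Sum>j<n. k j * (LINT x:\<Omega>|lborel. (norm (jacobian (midpt v j) (at x)))\<^sup>2))"
proof (intro allI impI)
  fix n
  assume "n \<le> N"
  then show "total_energy \<Omega> W \<gamma> (\<rho> n) (v n) (q n) = total_energy \<Omega> W \<gamma> (\<rho> 0) (v 0) (q 0)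
      - \<mu> * (\<Sum>j<n. k j * (LINT x:\<Omega>|lborel. (norm (jacobian (midpt v j) (at x)))\<^sup>2))"
  proof (induction n)
    case 0
    show ?case by simp
  next
    case (Suc n)
    then have n: "n < N" by simp
    have le: "m \<le> N" if "m \<in> {n, Suc n}" for m using that n by auto
    have v0: "v m x = 0" if "m \<le> N" "x \<in> frontier \<Omega>" for m x
      using that init_bdry(1) bdry(1) by (cases m) auto
    have q\<nu>: "q m x \<bullet> \<nu> x = 0" if "m \<le> N" "x \<in> regular_boundary \<Omega>" for m x
      using that init_bdry(2) bdry(2) by (cases m) auto
    have q\<rho>: "q m x = grad (\<rho> m) x" if "m \<le> N" "x \<in> \<Omega>" for m x
      using that init aux_gradient by (cases m) auto
    have k: "0 < k n" using step[OF n] partition(3)[OF n] by simp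
    have "total_energy \<Omega> W \<gamma> (\<rho> (Suc n)) (v (Suc n)) (q (Suc n)) = total_energy \<Omega> W \<gamma> (\<rho> n) (v n) (q n)
        - k n * \<mu> * (LINT x:\<Omega>|lborel. (norm (jacobian (midpt v n) (at x)))\<^sup>2)"
      by (rule energy_step[OF domain double_well_continuous_on[OF W] k smooth[OF le] admissible[OF le]
            v0[OF le] q\<nu>[OF le] q\<rho>[OF le] mass[OF n] momentum[OF n] potential[OF n]])
    then show ?case
      using Suc.IH n by (simp add: distrib_left mult.left_commute)
  qed
qed

end
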